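(* Let $(p_n)_n$ satisfy $0<p_n<n$ and $p_n=o(n)$, put $s_n=\frac{p_n}{n}\log(n/p_n)$ and $b_n=\sqrt{\log(n/p_n)}$, and let $\pi=\pi_n$ be a probability density on $[0,\infty)$ (possibly depending on $n$). Let $X^n\sim\mathcal N(\theta_0,I_n)$ and let $\theta$ have the scale-mixture-of-normals prior with mixing density $\pi$. Let $M_n$ be an arbitrary positive sequence tending to $+\infty$. All constants in the following hypotheses are independent of $n$. (C1) For some $b\ge 0$, $\pi(u)=L_n(u)e^{-bu}$, where for some $R,u_0\ge 1$ (not depending on $n$) $\frac1R\le \frac{L_n(au)}{L_n(u)}\le R$ for all $a\in[1,2]$ and all $u\ge u_0$; moreover there are constants $C',K,b'\ge 0$ and $u_*\ge 1$ such that $C'\pi(u)\ge (p_n/n)^K e^{-b'u}$ for all $u\ge u_*$. (C2) There is a constant $c>0$ such that $\int_0^1\pi(u)\,du\ge c$. (C3) There is a constant $C$ such that $$\int_{s_n}^\infty\Big(u\wedge\frac{b_n^3}{\sqrt u}\Big)\pi(u)\,du+b_n\int_1^{b_n^2}\frac{\pi(u)}{\sqrt u}\,du\le C s_n .$$ (CA) There is a constant $C$ such that $\pi(u)\le \frac{C}{u^{3/2}}\frac{p_n}{n}\sqrt{\log(n/p_n)}$ for all $u\ge s_n$. (CB) There is a constant $C$ such that $\int_{s_n}^\infty\pi(u)\,du\le C\frac{p_n}{n}$. Then the following hold. (i) Under (C1), $$\sup_{\theta_0\in\ell_0[p_n]}\mathbb E_{\theta_0}\Pi\Big(\theta:\sum_{i:\theta_i^0\ne0}(\theta_i-\theta_i^0)^2>M_np_n\log(n/p_n)\,\Big|\,X^n\Big)\to0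 \quad\text{and}\quad \sup_{\theta_0\in\ell_0[p_n]}\mathbb E_{\theta_0}\sum_{i:\theta_i^0\ne0}(\widehat\theta_i-\theta_i^0)^2\lesssim p_n\log(n/p_n).$$ (ii) Under (C2) and (C3), or under (CA), or under (CB), $$\sup_{\theta_0\in\ell_0[p_n]}\mathbb E_{\theta_0}\Pi\Big(\theta:\sum_{i:\theta_i^0=0}\theta_i^2>M_np_n\log(n/p_n)\,\Big|\,X^n\Big)\to0 \quad\text{and}\quad \sup_{\theta_0\in\ell_0[p_n]}\mathbb E_{\theta_0}\sum_{i:\theta_i^0=0}\widehat\theta_i^2\lesssim p_n\log(n/p_n).$$ (iii) Under (C1), (C2) and (C3), or under (C1) and (CA), or under (C1) and (CB), $$\sup_{\theta_0\in\ell_0[p_n]}\mathbb E_{\theta_0}\Pi\big(\theta:\|\theta-\theta_0\|^2>M_np_n\log(n/p_n)\,\big|\,X^n\big)\to0 \quad\text{and}\quad \sup_{\theta_0\in\ell_0[p_n]}\mathbb E_{\theta_0}\|\widehat\theta-\theta_0\|^2\lesssim p_n\log(n/p_n).$$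
   Context: Model: for each $n$, $X^n=(X_1,\dots,X_n)\sim\mathcal N(\theta_0,I_n)$ with $\theta_0=(\theta_i^0)_{i=1,\dots,n}\in\mathbb R^n$; $\mathbb E_{\theta_0}$ is expectation under this law. $\ell_0[p_n]=\{\theta\in\mathbb R^n:\sum_{i=1}^n\mathbf 1\{\theta_i\ne0\}\le p_n\}$. Prior (scale mixture of normals with mixing density $\pi$): independently for $i=1,\dots,n$, $\theta_i\mid\sigma_i^2\sim\mathcal N(0,\sigma_i^2)$ and $\sigma_i^2\sim\pi$, where $\pi$ is a (possibly $n$-dependent) probability density on $[0,\infty)$, with no further hyperpriors. $\Pi(\cdot\mid X^n)$ is the resulting posterior distribution of $\theta=(\theta_1,\dots,\theta_n)$ when $X^n\mid\theta\sim\mathcal N(\theta,I_n)$. $\widehat\theta=(\widehat\theta_1,\dots,\widehat\theta_n)$ is the coordinatewise posterior mean, $\widehat\theta_i=X_im_{X_i}$ with $$m_x=\frac{\int_0^\infty u(1+u)^{-3/2}e^{\frac{x^2u}{2+2u}}\pi(u)\,du}{\int_0^\infty(1+u)^{-1/2}e^{\frac{x^2u}{2+2u}}\pi(u)\,du}.$$ $\|\cdot\|$ is the Euclidean norm and $a\wedge b=\min\{a,b\}$. Limits are as $n\to\infty$; $A_n\lesssim B_n$ means $A_n\le C_0B_n$ for all sufficiently large $n$ with a constant $C_0$ independent of $n$. *)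

theory Defs
  imports "HOL-Probability.Probability"
begin

text \<open>
  A vector of \<open>\<real>\<^sup>n\<close> is an extensional function on the index set \<open>{1..n}\<close>, i.e. an element of
  the space of \<open>Rn n\<close>.
\<close>

abbreviation Rn :: "nat \<Rightarrow> (nat \<Rightarrow> real) measure" where
  "Rn n \<equiv> (\<Pi>\<^sub>M i\<in>{1..n}. (borel :: real measure))"

definition sparse :: "nat \<Rightarrow> real \<Rightarrow> (nat \<Rightarrow> real) set" where
  "sparse n p = {\<theta> \<in> space (Rn n). real (card {i \<in> {1..n}. \<theta> i \<noteq> 0}) \<le> p}"

text \<open>Normal law with given mean and \<^emph>\<open>variance\<close>; variance \<open>0\<close> gives the point mass.\<close>

definition normal_law :: "real \<Rightarrow> real \<Rightarrow> real measure" where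
  "normal_law \<mu> v =
     (if v = 0 then return borel \<mu> else density lborel (normal_density \<mu> (sqrt v)))"

definition data_law :: "nat \<Rightarrow> (nat \<Rightarrow> real) \<Rightarrow> (nat \<Rightarrow> real) measure" where
  "data_law n \<theta> = (\<Pi>\<^sub>M i\<in>{1..n}. normal_law (\<theta> i) 1)"

text \<open>A density on \<open>[0,\<infinity>)\<close> is extended to the real line by \<open>0\<close>.\<close>

definition mixing_density :: "(real \<Rightarrow> real) \<Rightarrow> bool" where
  "mixing_density \<pi> \<longleftrightarrow> \<pi> \<in> borel_measurable borel \<and> (\<forall>u. 0 \<le> \<pi> u) \<and> (\<forall>u<0. \<pi> u = 0) \<and>
     prob_space (density lborel \<pi>)"

definition prior1 :: "(real \<Rightarrow> real) \<Rightarrow> real measure" where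
  "prior1 \<pi> = density lborel \<pi> \<bind> (\<lambda>v. normal_law 0 v)"

definition prior :: "nat \<Rightarrow> (real \<Rightarrow> real) \<Rightarrow> (nat \<Rightarrow> real) measure" where
  "prior n \<pi> = (\<Pi>\<^sub>M i\<in>{1..n}. prior1 \<pi>)"

definition likelihood :: "nat \<Rightarrow> (nat \<Rightarrow> real) \<Rightarrow> (nat \<Rightarrow> real) \<Rightarrow> real" where
  "likelihood n x \<theta> = (\<Prod>i\<in>{1..n}. normal_density (\<theta> i) 1 (x i))"

text \<open>The posterior is given by Bayes' formula.\<close>

definition posterior :: "nat \<Rightarrow> (real \<Rightarrow> real) \<Rightarrow> (nat \<Rightarrow> real) \<Rightarrow> (nat \<Rightarrow> real) measure" where
  "posterior n \<pi> x = density (prior n \<pi>)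
     (\<lambda>\<theta>. ennreal (likelihood n x \<theta>) / (\<integral>\<^sup>+\<theta>'. likelihood n x \<theta>' \<partial>prior n \<pi>))"

definition post_mean :: "nat \<Rightarrow> (real \<Rightarrow> real) \<Rightarrow> (nat \<Rightarrow> real) \<Rightarrow> nat \<Rightarrow> real" where
  "post_mean n \<pi> x i = (\<integral>\<theta>. \<theta> i \<partial>posterior n \<pi> x)"

text \<open>The factor \<open>m\<^sub>x\<close>; see \<open>post_mean_eq_shrinkage\<close> below.\<close>

definition shrinkage :: "(real \<Rightarrow> real) \<Rightarrow> real \<Rightarrow> real" where
  "shrinkage \<pi> x =
     (LBINT u:{0..}. u * (1 + u) powr (-3/2) * exp (x\<^sup>2 * u / (2 + 2 * u)) * \<pi> u) /
     (LBINT u:{0..}. (1 + u) powr (-1/2) * exp (x\<^sup>2 * u / (2 + 2 * u)) * \<pi> u)"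

text \<open>
  Worst-case expectation of a nonnegative quantity \<open>f \<theta>0 x\<close>, valued in \<open>[0,\<infinity>]\<close> so that no
  integrability or boundedness has to be presupposed.
\<close>

definition sup_exp :: "nat \<Rightarrow> real \<Rightarrow> ((nat \<Rightarrow> real) \<Rightarrow> (nat \<Rightarrow> real) \<Rightarrow> ennreal) \<Rightarrow> ennreal" where
  "sup_exp n p f = (SUP \<theta>0\<in>sparse n p. \<integral>\<^sup>+x. f \<theta>0 x \<partial>data_law n \<theta>0)"

definition s_seq :: "(nat \<Rightarrow> real) \<Rightarrow> nat \<Rightarrow> real" where
  "s_seq p n = p n / n * ln (n / p n)"

definition b_seq :: "(nat \<Rightarrow> real) \<Rightarrow> nat \<Rightarrow> real" where
  "b_seq p n = sqrt (ln (n / p n))"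

text \<open>
  All constants are independent of \<open>n\<close>. As \<open>y / 0 = 0\<close>, the lower bound \<open>1 / R\<close> on the ratio
  forces \<open>L n u \<noteq> 0\<close> for \<open>u \<ge> u0\<close>.
\<close>

definition cond_C1 :: "(nat \<Rightarrow> real) \<Rightarrow> (nat \<Rightarrow> real \<Rightarrow> real) \<Rightarrow> bool" where
  "cond_C1 p \<pi> \<longleftrightarrow>
     (\<exists>b L R u0. b \<ge> 0 \<and> R \<ge> 1 \<and> u0 \<ge> 1 \<and>
        (\<forall>n\<ge>1. (\<forall>u\<ge>0. \<pi> n u = L n u * exp (- b * u)) \<and>
          (\<forall>a\<in>{1..2}. \<forall>u\<ge>u0. 1 / R \<le> L n (a * u) / L n u \<and> L n (a * u) / L n u \<le> R))) \<and>
     (\<exists>C' K b' u1. C' \<ge> 0 \<and> K \<ge> 0 \<and> b' \<ge> 0 \<and> u1 \<ge> 1 \<and>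
        (\<forall>n\<ge>1. \<forall>u\<ge>u1. C' * \<pi> n u \<ge> (p n / n) powr K * exp (- b' * u)))"

definition cond_C2 :: "(nat \<Rightarrow> real \<Rightarrow> real) \<Rightarrow> bool" where
  "cond_C2 \<pi> \<longleftrightarrow> (\<exists>c>0. \<forall>n\<ge>1. (LBINT u:{0..1}. \<pi> n u) \<ge> c)"

text \<open>
  For the finitely many \<open>n\<close> with \<open>b_seq p n < 1\<close> the second integral is over the empty set.
\<close>

definition cond_C3 :: "(nat \<Rightarrow> real) \<Rightarrow> (nat \<Rightarrow> real \<Rightarrow> real) \<Rightarrow> bool" where
  "cond_C3 p \<pi> \<longleftrightarrow> (\<exists>C. \<forall>n\<ge>1.
     (LBINT u:{s_seq p n..}. min u (b_seq p n ^ 3 / sqrt u) * \<pi> n u) +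
     b_seq p n * (LBINT u:{1..(b_seq p n)\<^sup>2}. \<pi> n u / sqrt u) \<le> C * s_seq p n)"

definition cond_CA :: "(nat \<Rightarrow> real) \<Rightarrow> (nat \<Rightarrow> real \<Rightarrow> real) \<Rightarrow> bool" where
  "cond_CA p \<pi> \<longleftrightarrow> (\<exists>C. \<forall>n\<ge>1. \<forall>u\<ge>s_seq p n.
     \<pi> n u \<le> C / u powr (3/2) * (p n / n) * sqrt (ln (n / p n)))"

definition cond_CB :: "(nat \<Rightarrow> real) \<Rightarrow> (nat \<Rightarrow> real \<Rightarrow> real) \<Rightarrow> bool" where
  "cond_CB p \<pi> \<longleftrightarrow> (\<exists>C. \<forall>n\<ge>1. (LBINT u:{s_seq p n..}. \<pi> n u) \<le> C * (p n / n))"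

text \<open>
  The prior and the posterior are probability measures, and the mean of the posterior is given
  coordinatewise by \<open>x i * shrinkage \<pi> (x i)\<close>.
\<close>

lemma normal_density_sqrt_neg: "v < 0 \<Longrightarrow> normal_density \<mu> (sqrt v) = normal_density \<mu> (sqrt (- v))"
  by (auto simp: normal_density_def real_sqrt_minus)

lemma prob_space_normal_law: "prob_space (normal_law \<mu> v)"
proof -
  consider "v = 0" | "v > 0" | "v < 0" by linarith
  then show ?thesis
  proof cases
    case 3
    then have "prob_space (density lborel (normal_density \<mu> (sqrt (- v))))"
      by (intro prob_space_normal_density) auto
    then show ?thesis using 3 by (simp add: normal_law_def normal_density_sqrt_neg[OF 3])
  qed (auto simp: normal_law_def intro: prob_space_return prob_space_normal_density)
qed

lemma sets_normal_law [simp]: "sets (normal_law \<mu> v) = sets borel"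
  by (simp add: normal_law_def)

lemma space_normal_law [simp]: "space (normal_law \<mu> v) = UNIV"
  by (simp add: normal_law_def)

lemma measurable_normal_law: "normal_law 0 \<in> borel \<rightarrow>\<^sub>M prob_algebra borel"
proof (rule measurable_prob_algebraI)
  show "normal_law 0 \<in> borel \<rightarrow>\<^sub>M subprob_algebra borel"
  proof (rule measurable_subprob_algebra)
    fix A :: "real set" assume A [measurable]: "A \<in> sets borel"
    have "(\<lambda>v. emeasure (normal_law 0 v) A) = (\<lambda>v. if v = 0 then indicator A 0 else
        (\<integral>\<^sup>+x. ennreal (1 / sqrt (2 * pi * (sqrt v)\<^sup>2) * exp (-(x - 0)\<^sup>2/ (2 * (sqrt v)\<^sup>2))) * indicator A x \<partial>lborel))"
      by (auto simp: normal_law_def emeasure_density normal_density_def)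
    also have "\<dots> \<in> borel_measurable borel" by measurable
    finally show "(\<lambda>v. emeasure (normal_law 0 v) A) \<in> borel_measurable borel" .
  qed (auto intro: prob_space_imp_subprob_space prob_space_normal_law)
qed (rule prob_space_normal_law)

lemma mixing_density_prob_algebra:
  "mixing_density \<pi> \<Longrightarrow> density lborel \<pi> \<in> space (prob_algebra borel)"
  by (auto simp: mixing_density_def space_prob_algebra)

lemma prob_space_prior1: "mixing_density \<pi> \<Longrightarrow> prob_space (prior1 \<pi>)"
  unfolding prior1_def
  using prob_space_bind'[OF mixing_density_prob_algebra measurable_normal_law] by auto

lemma sets_prior1: "mixing_density \<pi> \<Longrightarrow> sets (prior1 \<pi>) = sets borel"
  unfolding prior1_def
  using sets_bind'[OF mixing_density_prob_algebra measurable_normal_law] by auto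

lemma space_prior1: "mixing_density \<pi> \<Longrightarrow> space (prior1 \<pi>) = UNIV"
  using sets_eq_imp_space_eq[OF sets_prior1] by simp

lemma prob_space_prior: "mixing_density \<pi> \<Longrightarrow> prob_space (prior n \<pi>)"
  unfolding prior_def by (intro prob_space_PiM prob_space_prior1)

lemma sets_prior: "mixing_density \<pi> \<Longrightarrow> sets (prior n \<pi>) = sets (Rn n)"
  unfolding prior_def by (intro sets_PiM_cong refl sets_prior1)

lemma integral_prior1:
  assumes \<pi>: "mixing_density \<pi>" and f [measurable]: "f \<in> borel_measurable borel"
    and B: "\<And>x. \<bar>f x\<bar> \<le> (B :: real)"
  shows "(\<integral>x. f x \<partial>prior1 \<pi>) = (\<integral>u. \<pi> u * (\<integral>x. f x \<partial>normal_law 0 u) \<partial>lborel)"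
    and "integrable (prior1 \<pi>) f"
    and "integrable lborel (\<lambda>u. \<pi> u * (\<integral>x. f x \<partial>normal_law 0 u))"
proof -
  have [measurable]: "\<pi> \<in> borel_measurable borel" and nn: "\<And>u. 0 \<le> \<pi> u"
    and P: "prob_space (density lborel \<pi>)"
    using \<pi> by (auto simp: mixing_density_def)
  interpret P: prob_space "density lborel \<pi>" by fact
  interpret N: prob_space "normal_law 0 v" for v by (rule prob_space_normal_law)
  interpret Q: prob_space "prior1 \<pi>" by (rule prob_space_prior1[OF \<pi>])
  have K: "normal_law 0 \<in> borel \<rightarrow>\<^sub>M subprob_algebra borel"
    by (rule measurable_prob_algebraD[OF measurable_normal_law])
  have K': "normal_law 0 \<in> density lborel \<pi> \<rightarrow>\<^sub>M subprob_algebra borel"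
    using K by (simp cong: measurable_cong_sets)
  have m: "(\<lambda>u. \<integral>x. f x \<partial>normal_law 0 u) \<in> borel_measurable borel"
    by (rule measurable_compose[OF K integral_measurable_subprob_algebra]) measurable
  have b: "\<bar>\<integral>x. f x \<partial>normal_law 0 u\<bar> \<le> B" for u
  proof -
    have "\<bar>\<integral>x. f x \<partial>normal_law 0 u\<bar> \<le> (\<integral>x. \<bar>f x\<bar> \<partial>normal_law 0 u)"
      by simp
    also have "\<dots> \<le> B"
      by (rule N.integral_le_const) (auto intro!: N.integrable_const_bound[where B=B] B cong: measurable_cong_sets)
    finally show ?thesis .
  qed
  show "integrable (prior1 \<pi>) f"
    by (rule Q.integrable_const_bound[where B=B]) (auto simp: B sets_prior1[OF \<pi>] cong: measurable_cong_sets)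
  have "integrable (density lborel \<pi>) (\<lambda>u. \<integral>x. f x \<partial>normal_law 0 u)"
    by (rule P.integrable_const_bound[where B=B]) (use m b in auto)
  then show "integrable lborel (\<lambda>u. \<pi> u * (\<integral>x. f x \<partial>normal_law 0 u))"
    using m nn by (subst (asm) integrable_real_density) auto
  have "(\<integral>x. f x \<partial>prior1 \<pi>) = (\<integral>u. (\<integral>x. f x \<partial>normal_law 0 u) \<partial>density lborel \<pi>)"
    unfolding prior1_def
    by (rule integral_bind[where K=borel and B=B and B'=1])
       (use K' B in \<open>auto simp: P.finite_measure_axioms N.emeasure_space_1[unfolded space_normal_law]\<close>)
  also have "\<dots> = (\<integral>u. \<pi> u * (\<integral>x. f x \<partial>normal_law 0 u) \<partial>lborel)"
    using m nn by (subst integral_real_density) auto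
  finally show "(\<integral>x. f x \<partial>prior1 \<pi>) = (\<integral>u. \<pi> u * (\<integral>x. f x \<partial>normal_law 0 u) \<partial>lborel)" .
qed

lemma normal_density_mult:
  assumes "v > 0"
  shows "normal_density \<theta> 1 x * normal_density 0 (sqrt v) \<theta> =
    normal_density 0 (sqrt (1 + v)) x * normal_density (v * x / (1 + v)) (sqrt (v / (1 + v))) \<theta>"
proof -
  have nz: "1 + v \<noteq> 0" "v \<noteq> 0" using assms by auto
  have "- (x - \<theta>)\<^sup>2 / 2 + - \<theta>\<^sup>2 / (2 * v) =
      - x\<^sup>2 / (2 * (1 + v)) + - (\<theta> - v * x / (1 + v))\<^sup>2 / (2 * (v / (1 + v)))"
  proof -
    have sq: "\<theta> - v * x / (1 + v) = ((1 + v) * \<theta> - v * x) / (1 + v)"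
      using nz by (simp add: field_simps)
    have "(\<theta> - v * x / (1 + v))\<^sup>2 / (2 * (v / (1 + v))) = ((1 + v) * \<theta> - v * x)\<^sup>2 / (2 * v * (1 + v))"
      unfolding sq power_divide using nz by (simp add: power2_eq_square)
    also have "\<dots> = (x - \<theta>)\<^sup>2 / 2 + \<theta>\<^sup>2 / (2 * v) - x\<^sup>2 / (2 * (1 + v))"
      using nz by (simp add: divide_simps) (simp add: power2_eq_square algebra_simps)
    finally show ?thesis by simp
  qed
  then have e: "exp (- (x - \<theta>)\<^sup>2 / 2) * exp (- \<theta>\<^sup>2 / (2 * v)) =
      exp (- x\<^sup>2 / (2 * (1 + v))) * exp (- (\<theta> - v * x / (1 + v))\<^sup>2 / (2 * (v / (1 + v))))"
    unfolding exp_add[symmetric] by simp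
  have c: "1 / sqrt (2 * pi) * (1 / sqrt (2 * pi * v)) =
      1 / sqrt (2 * pi * (1 + v)) * (1 / sqrt (2 * pi * (v / (1 + v))))"
    using assms by (simp add: real_sqrt_mult[symmetric] field_simps)
  have s: "(sqrt v)\<^sup>2 = v" "(sqrt (1 + v))\<^sup>2 = 1 + v" "(sqrt (v / (1 + v)))\<^sup>2 = v / (1 + v)"
    using assms by auto
  show ?thesis
    unfolding normal_density_def s
    using arg_cong2[where f="(*)", OF c e]
    by (simp add: mult_ac)
qed

lemma integral_normal_law:
  assumes "v \<ge> 0"
  shows "(\<integral>\<theta>. normal_density \<theta> 1 x \<partial>normal_law 0 v) = normal_density 0 (sqrt (1 + v)) x"
    and "(\<integral>\<theta>. \<theta> * normal_density \<theta> 1 x \<partial>normal_law 0 v) =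
      x * v / (1 + v) * normal_density 0 (sqrt (1 + v)) x"
proof -
  have [measurable]: "(\<lambda>\<theta>. normal_density \<theta> 1 x) \<in> borel_measurable borel"
    by (simp add: normal_density_def)
  note nm = normal_density_mult[of v _ x]
  have "(\<integral>\<theta>. normal_density \<theta> 1 x \<partial>normal_law 0 v) = normal_density 0 (sqrt (1 + v)) x \<and>
    (\<integral>\<theta>. \<theta> * normal_density \<theta> 1 x \<partial>normal_law 0 v) =
      x * v / (1 + v) * normal_density 0 (sqrt (1 + v)) x"
  proof (cases "v = 0")
    case True
    then show ?thesis
      by (simp add: normal_law_def integral_return normal_density_def)
  next
    case False
    with assms have v: "v > 0" by simp
    let ?m = "v * x / (1 + v)" and ?s = "sqrt (v / (1 + v))"
    have s: "?s > 0" using v by simp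
    have 1: "(\<integral>\<theta>. normal_density \<theta> 1 x \<partial>normal_law 0 v) =
        (\<integral>\<theta>. normal_density 0 (sqrt (1 + v)) x * normal_density ?m ?s \<theta> \<partial>lborel)"
      using v by (simp add: normal_law_def integral_real_density nm[symmetric] mult.commute)
    have nm': "normal_density 0 (sqrt v) \<theta> * (\<theta> * normal_density \<theta> 1 x) =
        normal_density 0 (sqrt (1 + v)) x * (normal_density ?m ?s \<theta> * \<theta>)" for \<theta>
      using nm[OF v, of \<theta>] by (metis mult.assoc mult.commute)
    have "(\<integral>\<theta>. \<theta> * normal_density \<theta> 1 x \<partial>normal_law 0 v) =
        (\<integral>\<theta>. normal_density 0 (sqrt v) \<theta> * (\<theta> * normal_density \<theta> 1 x) \<partial>lborel)"
      using v by (simp add: normal_law_def integral_real_density)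
    then have 2: "(\<integral>\<theta>. \<theta> * normal_density \<theta> 1 x \<partial>normal_law 0 v) =
        (\<integral>\<theta>. normal_density 0 (sqrt (1 + v)) x * (normal_density ?m ?s \<theta> * \<theta>) \<partial>lborel)"
      unfolding nm' .
    show ?thesis
      unfolding 1 2 integral_mult_right_zero integral_normal_density[OF s] integral_normal_moment_nz_1[OF s]
      by simp
  qed
  then show "(\<integral>\<theta>. normal_density \<theta> 1 x \<partial>normal_law 0 v) = normal_density 0 (sqrt (1 + v)) x"
    and "(\<integral>\<theta>. \<theta> * normal_density \<theta> 1 x \<partial>normal_law 0 v) =
      x * v / (1 + v) * normal_density 0 (sqrt (1 + v)) x" by auto
qed

lemma normal_density_1_le: "normal_density \<theta> 1 x \<le> 1"
proof -
  have "1 \<le> sqrt (2 * pi)" using pi_gt3 by (simp add: real_le_rsqrt)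
  moreover have "exp (- (x - \<theta>)\<^sup>2 / 2) \<le> 1" by simp
  ultimately have "exp (- (x - \<theta>)\<^sup>2 / 2) \<le> sqrt (2 * pi)" by linarith
  then show ?thesis by (simp add: normal_density_def divide_simps)
qed

lemma mult_normal_density_1_le: "\<bar>\<theta> * normal_density \<theta> 1 x\<bar> \<le> \<bar>x\<bar> + 1"
proof -
  let ?t = "\<theta> - x"
  have "\<bar>t\<bar> \<le> 1 + t\<^sup>2 / 2" for t :: real
    using zero_le_power2[of "\<bar>t\<bar> - 1"] power2_diff[of "\<bar>t\<bar>" 1] by simp
  then have "\<bar>?t\<bar> \<le> 1 + ?t\<^sup>2 / 2" .
  also have "\<dots> \<le> exp (?t\<^sup>2 / 2)" by (rule exp_ge_add_one_self)
  finally have t: "\<bar>?t\<bar> * exp (- (?t\<^sup>2 / 2)) \<le> 1"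
    by (simp add: exp_minus field_simps)
  have p: "1 \<le> sqrt (2 * pi)" using pi_gt3 by (simp add: real_le_rsqrt)
  have "\<bar>?t\<bar> * normal_density \<theta> 1 x = \<bar>?t\<bar> * exp (- (?t\<^sup>2 / 2)) / sqrt (2 * pi)"
    by (simp add: normal_density_def power2_commute)
  also have "\<dots> \<le> 1" using order_trans[OF t p] by (simp add: divide_simps)
  finally have a: "\<bar>?t\<bar> * normal_density \<theta> 1 x \<le> 1" .
  have "\<bar>\<theta> * normal_density \<theta> 1 x\<bar> = \<bar>\<theta>\<bar> * normal_density \<theta> 1 x"
    by (simp add: abs_mult)
  also have "\<dots> \<le> (\<bar>x\<bar> + \<bar>?t\<bar>) * normal_density \<theta> 1 x"
    by (intro mult_right_mono) auto
  also have "\<dots> \<le> \<bar>x\<bar> * 1 + 1"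
    unfolding distrib_right
    by (intro add_mono a mult_left_mono normal_density_1_le) auto
  finally show ?thesis by simp
qed


lemma normal_density_variance:
  assumes "u \<ge> 0"
  shows "normal_density 0 (sqrt (1 + u)) x =
    exp (- x\<^sup>2 / 2) / sqrt (2 * pi) * ((1 + u) powr (-1/2) * exp (x\<^sup>2 * u / (2 + 2 * u)))"
proof -
  have "- x\<^sup>2 / (2 * (1 + u)) = - x\<^sup>2 / 2 + x\<^sup>2 * u / (2 + 2 * u)"
    using assms by (simp add: divide_simps) (simp add: algebra_simps)
  moreover have "(1 + u) powr (-1/2) = 1 / sqrt (1 + u)"
    using assms by (simp add: powr_minus powr_half_sqrt[symmetric] divide_simps)
  ultimately show ?thesis
    using assms by (simp add: normal_density_def real_sqrt_mult exp_add[symmetric])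
qed

context
  fixes \<pi> :: "real \<Rightarrow> real"
  assumes \<pi>: "mixing_density \<pi>"
begin

private lemma \<pi>_neg: "u < 0 \<Longrightarrow> \<pi> u = 0"
  using \<pi> by (auto simp: mixing_density_def)

private abbreviation "Z1 x \<equiv> \<integral>\<theta>. normal_density \<theta> 1 x \<partial>prior1 \<pi>"
private abbreviation "N1 x \<equiv> \<integral>\<theta>. \<theta> * normal_density \<theta> 1 x \<partial>prior1 \<pi>"

private lemma meas [measurable]: "(\<lambda>\<theta>. normal_density \<theta> 1 x) \<in> borel_measurable borel"
  by (simp add: normal_density_def)

private lemma int_Z1: "integrable (prior1 \<pi>) (\<lambda>\<theta>. normal_density \<theta> 1 x)"
  by (rule integral_prior1(2)[OF \<pi>, where B=1]) (auto simp: normal_density_1_le)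

private lemma int_N1: "integrable (prior1 \<pi>) (\<lambda>\<theta>. \<theta> * normal_density \<theta> 1 x)"
  by (rule integral_prior1(2)[OF \<pi>, where B="\<bar>x\<bar> + 1"]) (auto simp: mult_normal_density_1_le)

private lemma Z1_pos: "Z1 x > 0"
proof -
  interpret prob_space "prior1 \<pi>" by (rule prob_space_prior1[OF \<pi>])
  have "Z1 x \<noteq> 0"
  proof
    assume "Z1 x = 0"
    then have "AE \<theta> in prior1 \<pi>. normal_density \<theta> 1 x = 0"
      using int_Z1 by (subst (asm) integral_nonneg_eq_0_iff_AE) auto
    then have "AE \<theta> in prior1 \<pi>. False"
      by (rule AE_mp) (auto simp: normal_density_def)
    then show False by (simp add: AE_False)
  qed
  moreover have "Z1 x \<ge> 0" by (rule integral_nonneg_AE) simp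
  ultimately show ?thesis by (metis order_le_less)
qed

private lemma N1_over_Z1: "N1 x / Z1 x = x * shrinkage \<pi> x"
proof -
  define k where "k = exp (- x\<^sup>2 / 2) / sqrt (2 * pi)"
  have k: "k \<noteq> 0" by (simp add: k_def)
  have "Z1 x = (\<integral>u. \<pi> u * (\<integral>\<theta>. normal_density \<theta> 1 x \<partial>normal_law 0 u) \<partial>lborel)"
    by (rule integral_prior1(1)[OF \<pi>, where B=1]) (auto simp: normal_density_1_le)
  also have "\<dots> = (\<integral>u. k * (indicator {0..} u *\<^sub>R
      ((1 + u) powr (-1/2) * exp (x\<^sup>2 * u / (2 + 2 * u)) * \<pi> u)) \<partial>lborel)"
  proof (intro Bochner_Integration.integral_cong refl)
    fix u
    show "\<pi> u * (\<integral>\<theta>. normal_density \<theta> 1 x \<partial>normal_law 0 u) = k * (indicator {0..} u *\<^sub>R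
      ((1 + u) powr (-1/2) * exp (x\<^sup>2 * u / (2 + 2 * u)) * \<pi> u))"
      by (cases "u < 0") (simp_all add: \<pi>_neg integral_normal_law normal_density_variance k_def)
  qed
  finally have Z: "Z1 x = k * (LBINT u:{0..}. (1 + u) powr (-1/2) * exp (x\<^sup>2 * u / (2 + 2 * u)) * \<pi> u)"
    unfolding set_lebesgue_integral_def by simp
  have "N1 x = (\<integral>u. \<pi> u * (\<integral>\<theta>. \<theta> * normal_density \<theta> 1 x \<partial>normal_law 0 u) \<partial>lborel)"
    by (rule integral_prior1(1)[OF \<pi>, where B="\<bar>x\<bar> + 1"]) (auto simp: mult_normal_density_1_le)
  also have "\<dots> = (\<integral>u. k * x * (indicator {0..} u *\<^sub>R
      (u * (1 + u) powr (-3/2) * exp (x\<^sup>2 * u / (2 + 2 * u)) * \<pi> u)) \<partial>lborel)"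
  proof (intro Bochner_Integration.integral_cong refl)
    fix u
    show "\<pi> u * (\<integral>\<theta>. \<theta> * normal_density \<theta> 1 x \<partial>normal_law 0 u) = k * x * (indicator {0..} u *\<^sub>R
      (u * (1 + u) powr (-3/2) * exp (x\<^sup>2 * u / (2 + 2 * u)) * \<pi> u))"
    proof (cases "u < 0")
      case False
      then have "(1 + u) powr (-3/2) = (1 + u) powr (-1/2) / (1 + u)"
        using powr_diff[of "1 + u" "-1/2" 1] by simp
      with False show ?thesis
        by (simp add: integral_normal_law normal_density_variance k_def mult_ac)
    qed (simp add: \<pi>_neg)
  qed
  finally have N: "N1 x = k * x *
      (LBINT u:{0..}. u * (1 + u) powr (-3/2) * exp (x\<^sup>2 * u / (2 + 2 * u)) * \<pi> u)"
    unfolding set_lebesgue_integral_def by simp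
  show ?thesis unfolding Z N shrinkage_def using k by simp
qed

private lemma prod_integrals:
  fixes f :: "nat \<Rightarrow> real \<Rightarrow> real"
  assumes "\<And>i. i \<in> {1..n} \<Longrightarrow> integrable (prior1 \<pi>) (f i)"
  shows "(\<integral>\<theta>. (\<Prod>i\<in>{1..n}. f i (\<theta> i)) \<partial>prior n \<pi>) = (\<Prod>i\<in>{1..n}. \<integral>t. f i t \<partial>prior1 \<pi>)"
    and "integrable (prior n \<pi>) (\<lambda>\<theta>. \<Prod>i\<in>{1..n}. f i (\<theta> i))"
proof -
  interpret prob_space "prior1 \<pi>" by (rule prob_space_prior1[OF \<pi>])
  interpret product_sigma_finite "\<lambda>_::nat. prior1 \<pi>" by standard
  show "(\<integral>\<theta>. (\<Prod>i\<in>{1..n}. f i (\<theta> i)) \<partial>prior n \<pi>) = (\<Prod>i\<in>{1..n}. \<integral>t. f i t \<partial>prior1 \<pi>)"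
    unfolding prior_def by (rule product_integral_prod) (use assms in auto)
  show "integrable (prior n \<pi>) (\<lambda>\<theta>. \<Prod>i\<in>{1..n}. f i (\<theta> i))"
    unfolding prior_def by (rule product_integrable_prod) (use assms in auto)
qed

private lemma likelihood_nonneg: "likelihood n x \<theta> \<ge> 0"
  unfolding likelihood_def by (intro prod_nonneg) auto

private lemma nn_integral_likelihood:
  "(\<integral>\<^sup>+\<theta>. likelihood n x \<theta> \<partial>prior n \<pi>) = ennreal (\<Prod>i\<in>{1..n}. Z1 (x i))"
proof -
  have "(\<integral>\<^sup>+\<theta>. likelihood n x \<theta> \<partial>prior n \<pi>) = ennreal (\<integral>\<theta>. likelihood n x \<theta> \<partial>prior n \<pi>)"
    unfolding likelihood_def
    by (rule nn_integral_eq_integral[OF prod_integrals(2)[OF int_Z1]]) (auto intro!: prod_nonneg)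
  also have "(\<integral>\<theta>. likelihood n x \<theta> \<partial>prior n \<pi>) = (\<Prod>i\<in>{1..n}. Z1 (x i))"
    unfolding likelihood_def by (rule prod_integrals) (rule int_Z1)
  finally show ?thesis .
qed

private lemma prod_Z1_pos: "(\<Prod>i\<in>{1..n}. Z1 (x i)) > 0"
  by (intro prod_pos) (auto simp: Z1_pos)

private lemma likelihood_measurable: "likelihood n x \<in> borel_measurable (prior n \<pi>)"
  unfolding likelihood_def
  by (rule borel_measurable_integrable) (rule prod_integrals(2), rule int_Z1)

private lemma posterior_eq: "posterior n \<pi> x =
    density (prior n \<pi>) (\<lambda>\<theta>. ennreal (likelihood n x \<theta> / (\<Prod>i\<in>{1..n}. Z1 (x i))))"
  unfolding posterior_def nn_integral_likelihood
  by (simp only: divide_ennreal[OF likelihood_nonneg prod_Z1_pos])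

lemma prob_space_posterior: "prob_space (posterior n \<pi> x)"
proof
  have [measurable]: "likelihood n x \<in> borel_measurable (prior n \<pi>)"
    by (rule likelihood_measurable)
  have "emeasure (posterior n \<pi> x) (space (posterior n \<pi> x)) =
      (\<integral>\<^sup>+\<theta>. ennreal (likelihood n x \<theta>) / ennreal (\<Prod>i\<in>{1..n}. Z1 (x i)) \<partial>prior n \<pi>)"
    by (simp add: posterior_def nn_integral_likelihood emeasure_density cong: nn_integral_cong)
  also have "\<dots> = (\<integral>\<^sup>+\<theta>. likelihood n x \<theta> \<partial>prior n \<pi>) / ennreal (\<Prod>i\<in>{1..n}. Z1 (x i))"
    by (rule nn_integral_divide) measurable
  also have "\<dots> = 1"
  proof -
    have "ennreal r / ennreal r = 1" if "r > 0" for r :: real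
      using that by (simp add: divide_ennreal)
    from this[OF prod_Z1_pos[of x n]] show ?thesis unfolding nn_integral_likelihood .
  qed
  finally show "emeasure (posterior n \<pi> x) (space (posterior n \<pi> x)) = 1" .
qed

lemma post_mean_eq_shrinkage:
  assumes i: "i \<in> {1..n}"
  shows "integrable (posterior n \<pi> x) (\<lambda>\<theta>. \<theta> i)"
    and "post_mean n \<pi> x i = x i * shrinkage \<pi> (x i)"
proof -
  let ?Z = "\<Prod>j\<in>{1..n}. Z1 (x j)"
  define f where "f j t = (if j = i then t else 1) * normal_density t 1 (x j)" for j t
  have f: "integrable (prior1 \<pi>) (f j)" for j
    unfolding f_def using int_N1 int_Z1 by (cases "j = i") simp_all
  have lik: "likelihood n x \<theta> / ?Z * \<theta> i = (\<Prod>j\<in>{1..n}. f j (\<theta> j)) / ?Z" for \<theta>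
    using i by (simp add: likelihood_def f_def prod.distrib prod.delta)
  have [measurable]: "likelihood n x \<in> borel_measurable (prior n \<pi>)"
    by (rule likelihood_measurable)
  have [measurable]: "(\<lambda>\<theta>. \<theta> i) \<in> borel_measurable (prior n \<pi>)"
    using i by (simp add: sets_prior[OF \<pi>] cong: measurable_cong_sets)
  have nn: "likelihood n x \<theta> / ?Z \<ge> 0" for \<theta>
    using likelihood_nonneg[of n x \<theta>] prod_Z1_pos[of x n] by simp
  have m: "(\<lambda>\<theta>. likelihood n x \<theta> / ?Z) \<in> borel_measurable (prior n \<pi>)" "(\<lambda>\<theta>. \<theta> i) \<in> borel_measurable (prior n \<pi>)"
    by measurable
  have nn': "AE \<theta> in prior n \<pi>. 0 \<le> likelihood n x \<theta> / ?Z"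
    by (rule AE_I2) (rule nn)
  have "integrable (prior n \<pi>) (\<lambda>\<theta>. likelihood n x \<theta> / ?Z * \<theta> i)"
    unfolding lik by (intro integrable_divide prod_integrals f)
  then show "integrable (posterior n \<pi> x) (\<lambda>\<theta>. \<theta> i)"
    unfolding posterior_eq integrable_real_density[OF m(1) nn' m(2)] .
  have "post_mean n \<pi> x i = (\<integral>\<theta>. (\<Prod>j\<in>{1..n}. f j (\<theta> j)) / ?Z \<partial>prior n \<pi>)"
    unfolding post_mean_def posterior_eq integral_real_density[OF m(1) nn' m(2)] lik ..
  also have "\<dots> = (\<Prod>j\<in>{1..n}. \<integral>t. f j t \<partial>prior1 \<pi>) / ?Z"
    using prod_integrals(1)[of n f, OF f] by simp
  also have "\<dots> = (\<Prod>j\<in>{1..n}. (\<integral>t. f j t \<partial>prior1 \<pi>) / Z1 (x j))"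
    by (simp add: prod_dividef)
  also have "\<dots> = (\<Prod>j\<in>{1..n}. if j = i then N1 (x i) / Z1 (x i) else 1)"
    using Z1_pos by (intro prod.cong refl) (auto simp: f_def less_imp_neq[symmetric])
  also have "\<dots> = N1 (x i) / Z1 (x i)" using i by simp
  finally show "post_mean n \<pi> x i = x i * shrinkage \<pi> (x i)" by (simp add: N1_over_Z1)
qed

end

end

theory Submission
  imports Defs
begin

text \<open>
  Prior and likelihood are both products over the coordinates, so the posterior factorises, and
  everything follows from one function of one variable: the posterior second moment of
  \<open>\<theta>\<^sub>i\<close> about \<open>t\<close>, given that \<open>X\<^sub>i = x\<close>. This is \<open>coord_risk \<pi> t x\<close>. Markov's inequality
  bounds the posterior probability that \<open>\<Sum>\<^sub>i (\<theta>\<^sub>i - \<theta>0\<^sub>i)\<^sup>2\<close> exceeds \<open>M r\<close> by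
  \<open>(M r)\<^sup>-\<^sup>1 \<Sum>\<^sub>i coord_risk \<pi> \<theta>0\<^sub>i X\<^sub>i\<close>, and Jensen's inequality bounds the squared error of the
  posterior mean by the same sum. It therefore suffices to bound the expectation of this sum by a
  multiple of \<open>r = p log (n / p)\<close> (\<open>contraction_of_coord_risk\<close>). Throughout \<open>b\<^sup>2 = log (n / p)\<close>, so
  that \<open>p / n = exp (- b\<^sup>2)\<close> and \<open>s = b\<^sup>2 exp (- b\<^sup>2)\<close>.

  Given the scale \<open>u\<close>, the posterior of a coordinate is normal with mean \<open>k x\<close> and variance
  \<open>k = u / (1 + u)\<close>, and the posterior of \<open>u\<close> has a density proportional to
  \<open>\<pi> u * N(0, 1 + u)(x)\<close>. Hence \<open>coord_risk \<pi> t x\<close> is the average of \<open>k + (k x - t)\<^sup>2\<close> with these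
  weights.

  For a coordinate with \<open>t \<noteq> 0\<close> the bound needed is \<open>O(b\<^sup>2)\<close>, as there are at most \<open>p\<close> of them.
  Because \<open>k x - t = (x - t) - x / (1 + u)\<close>, it is enough to control the posterior mean of
  \<open>(x / (1 + u))\<^sup>2\<close>, the squared amount by which a large observation is shrunk. Scales with
  \<open>1 + u \<ge> \<bar>x\<bar> / (L b)\<close> contribute at most \<open>L\<^sup>2 b\<^sup>2\<close>. Smaller scales have a weight of at most order
  \<open>exp (- L b \<bar>x\<bar> / 2)\<close>, whereas the lower bound on \<open>\<pi>\<close> gives the scales in
  \<open>[\<bar>x\<bar>, 2 \<bar>x\<bar>]\<close> a weight of at least \<open>exp (- K b\<^sup>2 - O(\<bar>x\<bar>))\<close>, which is exponentially larger once
  \<open>L\<close> is large and \<open>\<bar>x\<bar> \<ge> b\<close> (\<open>shrinkage_gap_le\<close>, \<open>signal_risk_le\<close>).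

  For a coordinate with \<open>t = 0\<close> the bound needed is \<open>O(s)\<close>. Scales below \<open>s\<close> contribute
  \<open>s + s\<^sup>2 x\<^sup>2\<close>. If \<open>\<bar>x\<bar> > sqrt 2 * b\<close>, the crude bound \<open>1 + x\<^sup>2\<close> is enough, because its
  expectation over this event is of order \<open>b exp (- b\<^sup>2)\<close>. If \<open>\<bar>x\<bar> \<le> sqrt 2 * b\<close>, the
  normalising constant is at least a multiple of the standard normal density, since \<open>\<pi>\<close> puts mass on \<open>[0, 1]\<close>; integrating over \<open>x\<close>
  first, a scale \<open>u\<close> contributes a multiple of \<open>min u (b\<^sup>3 / sqrt u)\<close> (\<open>noise_risk_le\<close>). All that
  remains is the bound \<open>\<integral>\<^sub>s min u (b\<^sup>3 / sqrt u) * \<pi> u du = O(s)\<close> together with the mass on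
  \<open>[0, 1]\<close>, and each of the three alternative sets of hypotheses on the tail of \<open>\<pi>\<close> yields both
  (\<open>mixing_tail_eventually\<close>).
\<close>

section \<open>Posterior risk of one coordinate\<close>

text \<open>
  Up to normalisation, the posterior density of the scale \<open>u\<close> of a coordinate observed at \<open>x\<close>.
  For \<open>u < 0\<close> the normal density is meaningless, but there \<open>\<pi> u = 0\<close> for a mixing density.
\<close>

definition weight :: "(real \<Rightarrow> real) \<Rightarrow> real \<Rightarrow> real \<Rightarrow> real" where
  "weight \<pi> x u = \<pi> u * normal_density 0 (sqrt (1 + u)) x"

text \<open>The marginal density of a single observation.\<close>

definition evidence :: "(real \<Rightarrow> real) \<Rightarrow> real \<Rightarrow> ennreal" where
  "evidence \<pi> x = (\<integral>\<^sup>+u. weight \<pi> x u \<partial>lborel)"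

text \<open>
  The posterior second moment about \<open>t\<close> of a coordinate when its scale is known to be \<open>u\<close>:
  variance plus squared bias of the normal law with mean \<open>u / (1 + u) * x\<close> and variance \<open>u / (1 + u)\<close>.
\<close>

definition scale_risk :: "real \<Rightarrow> real \<Rightarrow> real \<Rightarrow> real" where
  "scale_risk t x u = u / (1 + u) + (u / (1 + u) * x - t)\<^sup>2"

text \<open>
  The posterior second moment of a coordinate about \<open>t\<close>, as a value in \<open>[0, \<infinity>]\<close>, so that sums,
  averages and Fubini need no integrability conditions.
\<close>

definition coord_risk :: "(real \<Rightarrow> real) \<Rightarrow> real \<Rightarrow> real \<Rightarrow> ennreal" where
  "coord_risk \<pi> t x =
     (\<integral>\<^sup>+u. ennreal (weight \<pi> x u) * ennreal (scale_risk t x u) \<partial>lborel) / evidence \<pi> x"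

lemma mixing_densityD:
  assumes "mixing_density \<pi>"
  shows "\<pi> \<in> borel_measurable borel" and "0 \<le> \<pi> u" and "u < 0 \<Longrightarrow> \<pi> u = 0"
    and "(\<integral>\<^sup>+u. \<pi> u \<partial>lborel) = 1" and "integrable lborel \<pi>"
proof -
  show 1 [measurable]: "\<pi> \<in> borel_measurable borel" and 2: "0 \<le> \<pi> u" and "u < 0 \<Longrightarrow> \<pi> u = 0" for u
    using assms by (auto simp: mixing_density_def)
  interpret prob_space "density lborel \<pi>" using assms by (simp add: mixing_density_def)
  show 4: "(\<integral>\<^sup>+u. \<pi> u \<partial>lborel) = 1"
    using emeasure_space_1 by (simp add: emeasure_density)
  show "integrable lborel \<pi>"
    by (rule integrableI_nonneg) (use 2 4 in auto)
qed

lemma measurable_normal_density [measurable (raw)]: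
  assumes [measurable]: "f \<in> borel_measurable M" "g \<in> borel_measurable M" "h \<in> borel_measurable M"
  shows "(\<lambda>z. normal_density (f z) (g z) (h z)) \<in> borel_measurable M"
  unfolding normal_density_def by measurable

lemma measurable_weight [measurable (raw)]:
  assumes [measurable]: "\<pi> \<in> borel_measurable borel" "f \<in> borel_measurable M" "g \<in> borel_measurable M"
  shows "(\<lambda>z. weight \<pi> (f z) (g z)) \<in> borel_measurable M"
  unfolding weight_def by measurable

lemma measurable_scale_risk [measurable (raw)]:
  assumes [measurable]: "f \<in> borel_measurable M" "g \<in> borel_measurable M"
  shows "(\<lambda>z. scale_risk t (f z) (g z)) \<in> borel_measurable M"
  unfolding scale_risk_def by measurable

lemma measurable_evidence [measurable]:
  assumes [measurable]: "\<pi> \<in> borel_measurable borel"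
  shows "evidence \<pi> \<in> borel_measurable borel"
  unfolding evidence_def by measurable

lemma measurable_coord_risk [measurable]:
  assumes [measurable]: "\<pi> \<in> borel_measurable borel"
  shows "coord_risk \<pi> t \<in> borel_measurable borel"
  unfolding coord_risk_def by measurable

lemma weight_nonneg: "mixing_density \<pi> \<Longrightarrow> 0 \<le> weight \<pi> x u"
  by (simp add: weight_def mixing_densityD(2))

text \<open>The version of \<open>integral_prior1\<close> for unbounded nonnegative functions.\<close>

lemma nn_integral_prior1:
  assumes \<pi>: "mixing_density \<pi>" and [measurable]: "f \<in> borel_measurable borel"
  shows "(\<integral>\<^sup>+\<theta>. f \<theta> \<partial>prior1 \<pi>) = (\<integral>\<^sup>+u. ennreal (\<pi> u) * (\<integral>\<^sup>+\<theta>. f \<theta> \<partial>normal_law 0 u) \<partial>lborel)"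
proof -
  note [measurable] = mixing_densityD(1)[OF \<pi>]
  have K: "normal_law 0 \<in> borel \<rightarrow>\<^sub>M subprob_algebra borel"
    by (rule measurable_prob_algebraD[OF measurable_normal_law])
  then have K': "normal_law 0 \<in> density lborel \<pi> \<rightarrow>\<^sub>M subprob_algebra borel"
    by (simp cong: measurable_cong_sets)
  have "(\<lambda>u. \<integral>\<^sup>+\<theta>. f \<theta> \<partial>normal_law 0 u) \<in> borel_measurable borel"
    by (rule measurable_compose[OF K nn_integral_measurable_subprob_algebra]) measurable
  then show ?thesis
    unfolding prior1_def by (subst nn_integral_bind[OF _ K']) (simp_all add: nn_integral_density)
qed

lemma nn_integral_normal_density:
  assumes "0 < \<sigma>"
  shows "(\<integral>\<^sup>+x. ennreal (normal_density m \<sigma> x) \<partial>lborel) = 1"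
  using assms by (subst nn_integral_eq_integral) auto

lemma nn_integral_normal_square:
  assumes s: "0 < \<sigma>"
  shows "(\<integral>\<^sup>+\<theta>. ennreal (normal_density m \<sigma> \<theta> * (\<theta> - t)\<^sup>2) \<partial>lborel) = ennreal (\<sigma>\<^sup>2 + (m - t)\<^sup>2)"
proof -
  have "has_bochner_integral lborel (\<lambda>\<theta>. normal_density m \<sigma> \<theta> * (\<theta> - m) ^ (2 * 1) +
      normal_density m \<sigma> \<theta> * (\<theta> - m) ^ (2 * 0 + 1) * (2 * (m - t)) +
      normal_density m \<sigma> \<theta> * (\<theta> - m) ^ (2 * 0) * (m - t)\<^sup>2)
    (fact (2 * 1) / ((2 / \<sigma>\<^sup>2) ^ 1 * fact 1) + 0 * (2 * (m - t)) +
      fact (2 * 0) / ((2 / \<sigma>\<^sup>2) ^ 0 * fact 0) * (m - t)\<^sup>2)"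
    by (intro has_bochner_integral_add has_bochner_integral_mult_left
        normal_moment_even[OF s] normal_moment_odd[OF s])
  also have "(\<lambda>\<theta>. normal_density m \<sigma> \<theta> * (\<theta> - m) ^ (2 * 1) +
      normal_density m \<sigma> \<theta> * (\<theta> - m) ^ (2 * 0 + 1) * (2 * (m - t)) +
      normal_density m \<sigma> \<theta> * (\<theta> - m) ^ (2 * 0) * (m - t)\<^sup>2) =
    (\<lambda>\<theta>. normal_density m \<sigma> \<theta> * (\<theta> - t)\<^sup>2)"
    by (auto simp: fun_eq_iff power2_eq_square algebra_simps)
  finally have "has_bochner_integral lborel (\<lambda>\<theta>. normal_density m \<sigma> \<theta> * (\<theta> - t)\<^sup>2) (\<sigma>\<^sup>2 + (m - t)\<^sup>2)"
    by simp
  then show ?thesis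
    by (subst nn_integral_eq_integral) (simp_all add: has_bochner_integral_iff)
qed

text \<open>
  Conjugacy: multiplying the normal prior with the likelihood gives the marginal density of the
  observation times the normal posterior. With \<open>normal_law\<close> on both sides this includes the
  degenerate prior \<open>v = 0\<close>.
\<close>

lemma nn_integral_normal_law_density:
  assumes v: "0 \<le> v" and [measurable]: "f \<in> borel_measurable borel" and f: "\<And>\<theta>. 0 \<le> f \<theta>"
  shows "(\<integral>\<^sup>+\<theta>. ennreal (normal_density \<theta> 1 x * f \<theta>) \<partial>normal_law 0 v) =
    ennreal (normal_density 0 (sqrt (1 + v)) x) * (\<integral>\<^sup>+\<theta>. f \<theta> \<partial>normal_law (v / (1 + v) * x) (v / (1 + v)))"
proof (cases "v = 0")
  case True
  then show ?thesis
    by (simp add: normal_law_def nn_integral_return ennreal_mult f)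
next
  case False
  with v have v: "0 < v" by simp
  have "(\<integral>\<^sup>+\<theta>. ennreal (normal_density \<theta> 1 x * f \<theta>) \<partial>normal_law 0 v) =
      (\<integral>\<^sup>+\<theta>. ennreal (normal_density \<theta> 1 x * normal_density 0 (sqrt v) \<theta>) * ennreal (f \<theta>) \<partial>lborel)"
    using v f by (simp add: normal_law_def nn_integral_density ennreal_mult mult_ac)
  also have "\<dots> = (\<integral>\<^sup>+\<theta>. ennreal (normal_density 0 (sqrt (1 + v)) x) *
      (ennreal (normal_density (v * x / (1 + v)) (sqrt (v / (1 + v))) \<theta>) * ennreal (f \<theta>)) \<partial>lborel)"
    by (simp add: normal_density_mult[OF v] ennreal_mult mult_ac)
  also have "\<dots> = ennreal (normal_density 0 (sqrt (1 + v)) x) *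
      (\<integral>\<^sup>+\<theta>. f \<theta> \<partial>normal_law (v / (1 + v) * x) (v / (1 + v)))"
    using v by (simp add: normal_law_def nn_integral_density nn_integral_cmult)
  finally show ?thesis .
qed

lemma nn_integral_normal_law_square:
  assumes "0 \<le> v"
  shows "(\<integral>\<^sup>+\<theta>. ennreal ((\<theta> - t)\<^sup>2) \<partial>normal_law m v) = ennreal (v + (m - t)\<^sup>2)"
  using assms nn_integral_normal_square[of "sqrt v" m t]
  by (auto simp: normal_law_def nn_integral_return nn_integral_density ennreal_mult)

lemma prior1_evidence:
  assumes \<pi>: "mixing_density \<pi>"
  shows "(\<integral>\<^sup>+\<theta>. normal_density \<theta> 1 x \<partial>prior1 \<pi>) = evidence \<pi> x"
proof -
  have "ennreal (\<pi> u) * (\<integral>\<^sup>+\<theta>. normal_density \<theta> 1 x \<partial>normal_law 0 u) = ennreal (weight \<pi> x u)" for u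
  proof (cases "u < 0")
    case False
    interpret prob_space "normal_law (u / (1 + u) * x) (u / (1 + u))" by (rule prob_space_normal_law)
    show ?thesis
      using False nn_integral_normal_law_density[of u "\<lambda>_. 1" x] emeasure_space_1
      by (simp add: weight_def ennreal_mult mixing_densityD(2)[OF \<pi>])
  qed (simp add: weight_def mixing_densityD(3)[OF \<pi>])
  then show ?thesis
    by (subst nn_integral_prior1[OF \<pi>]) (simp_all add: evidence_def)
qed

lemma prior1_square:
  assumes \<pi>: "mixing_density \<pi>"
  shows "(\<integral>\<^sup>+\<theta>. ennreal (normal_density \<theta> 1 x * (\<theta> - t)\<^sup>2) \<partial>prior1 \<pi>) =
    (\<integral>\<^sup>+u. ennreal (weight \<pi> x u) * ennreal (scale_risk t x u) \<partial>lborel)"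
proof -
  have "ennreal (\<pi> u) * (\<integral>\<^sup>+\<theta>. ennreal (normal_density \<theta> 1 x * (\<theta> - t)\<^sup>2) \<partial>normal_law 0 u) =
      ennreal (weight \<pi> x u) * ennreal (scale_risk t x u)" for u
  proof (cases "u < 0")
    case False
    then show ?thesis
      by (subst nn_integral_normal_law_density)
        (simp_all add: weight_def scale_risk_def ennreal_mult mixing_densityD(2)[OF \<pi>]
          nn_integral_normal_law_square mult_ac)
  qed (simp add: weight_def mixing_densityD(3)[OF \<pi>])
  then show ?thesis
    by (subst nn_integral_prior1[OF \<pi>]) simp_all
qed

lemma evidence_le_1:
  assumes \<pi>: "mixing_density \<pi>"
  shows "evidence \<pi> x \<le> 1"
proof -
  interpret prob_space "prior1 \<pi>" by (rule prob_space_prior1[OF \<pi>])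
  have "evidence \<pi> x \<le> (\<integral>\<^sup>+\<theta>. 1 \<partial>prior1 \<pi>)"
    unfolding prior1_evidence[OF \<pi>, symmetric]
    by (intro nn_integral_mono) (simp add: normal_density_1_le)
  then show ?thesis by (simp add: emeasure_space_1)
qed

lemma ennreal_mult_divide_le: "a \<noteq> top \<Longrightarrow> (a * b) / (a * c) \<le> b / (c :: ennreal)"
  by (cases "a = 0") (simp_all add: mult.commute[of a] divide_mult_eq)

text \<open>
  Valid without a side condition on \<open>D\<close>: if \<open>D\<close> is \<open>0\<close>, then so is \<open>A\<close>, and \<open>0 / 0 = 0\<close>; and
  anything divided by \<open>\<infinity>\<close> is \<open>0\<close>.
\<close>

lemma ennreal_divide_le_of_le_mult:
  assumes "(A :: ennreal) \<le> c * D"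
  shows "A / D \<le> c"
proof (cases "D = 0 \<or> D = top")
  case True
  then show ?thesis using assms by auto
next
  case False
  then have "A / D \<le> c * D / D" using assms by (intro divide_right_mono_ennreal)
  also have "\<dots> = c" using False by (intro ennreal_mult_divide_eq) (auto simp: top.not_eq_extremum)
  finally show ?thesis .
qed

text \<open>
  In the ratio given by Bayes' formula, both numerator and denominator are products over the
  coordinates, and all factors with \<open>j \<noteq> i\<close> cancel. For the upper bound it is enough that the
  common factor is not \<open>\<infinity>\<close>.
\<close>

lemma posterior_square_le:
  assumes \<pi>: "mixing_density \<pi>" and i: "i \<in> {1..n}"
  shows "(\<integral>\<^sup>+\<theta>. ennreal ((\<theta> i - t)\<^sup>2) \<partial>posterior n \<pi> x) \<le> coord_risk \<pi> t (x i)"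
proof -
  interpret prob_space "prior1 \<pi>" by (rule prob_space_prior1[OF \<pi>])
  interpret product_sigma_finite "\<lambda>_::nat. prior1 \<pi>" by standard
  have "(\<lambda>\<theta>. \<theta> i) \<in> borel_measurable (Rn n)"
    by (rule measurable_component_singleton[OF i])
  then have comp [measurable]: "(\<lambda>\<theta>. \<theta> i) \<in> borel_measurable (prior n \<pi>)"
    by (simp only: measurable_cong_sets[OF sets_prior[OF \<pi>] refl])
  have "likelihood n x \<in> borel_measurable (Rn n)"
    unfolding likelihood_def by measurable
  then have lik [measurable]: "likelihood n x \<in> borel_measurable (prior n \<pi>)"
    by (simp only: measurable_cong_sets[OF sets_prior[OF \<pi>] refl])
  have meas_prior1: "borel_measurable (prior1 \<pi>) = borel_measurable borel"
    by (rule measurable_cong_sets[OF sets_prior1[OF \<pi>] refl])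
  define f where "f g j = (\<lambda>t. ennreal (normal_density t 1 (x j)) * (if j = i then g t else 1))"
    for g j
  have factor: "(\<integral>\<^sup>+\<theta>. ennreal (likelihood n x \<theta>) * g (\<theta> i) \<partial>prior n \<pi>) =
      (\<Prod>j\<in>{1..n} - {i}. evidence \<pi> (x j)) * (\<integral>\<^sup>+s. ennreal (normal_density s 1 (x i)) * g s \<partial>prior1 \<pi>)"
    if [measurable]: "g \<in> borel_measurable borel" for g
  proof -
    have "(\<integral>\<^sup>+\<theta>. ennreal (likelihood n x \<theta>) * g (\<theta> i) \<partial>prior n \<pi>) =
        (\<integral>\<^sup>+\<theta>. (\<Prod>j\<in>{1..n}. f g j (\<theta> j)) \<partial>prior n \<pi>)"
      using i by (simp add: likelihood_def f_def prod.distrib prod.delta prod_ennreal)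
    also have "\<dots> = (\<Prod>j\<in>{1..n}. integral\<^sup>N (prior1 \<pi>) (f g j))"
      unfolding prior_def by (rule product_nn_integral_prod) (simp_all add: f_def meas_prior1)
    also have "\<dots> = integral\<^sup>N (prior1 \<pi>) (f g i) * (\<Prod>j\<in>{1..n} - {i}. integral\<^sup>N (prior1 \<pi>) (f g j))"
      using i by (intro prod.remove) auto
    also have "(\<Prod>j\<in>{1..n} - {i}. integral\<^sup>N (prior1 \<pi>) (f g j)) = (\<Prod>j\<in>{1..n} - {i}. evidence \<pi> (x j))"
      by (intro prod.cong) (auto simp: f_def prior1_evidence[OF \<pi>])
    finally show ?thesis by (simp add: f_def mult.commute)
  qed
  let ?a = "\<Prod>j\<in>{1..n} - {i}. evidence \<pi> (x j)"
  have "?a \<le> 1"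
    by (intro prod_le_1) (auto simp: evidence_le_1[OF \<pi>])
  then have a: "?a \<noteq> top" by (auto simp: top_unique)
  let ?Z = "\<integral>\<^sup>+\<theta>. ennreal (likelihood n x \<theta>) \<partial>prior n \<pi>"
  have "(\<integral>\<^sup>+\<theta>. ennreal ((\<theta> i - t)\<^sup>2) \<partial>posterior n \<pi> x) =
      (\<integral>\<^sup>+\<theta>. ennreal (likelihood n x \<theta>) / ?Z * ennreal ((\<theta> i - t)\<^sup>2) \<partial>prior n \<pi>)"
    unfolding posterior_def by (rule nn_integral_density) measurable
  also have "\<dots> = (\<integral>\<^sup>+\<theta>. ennreal (likelihood n x \<theta>) * ennreal ((\<theta> i - t)\<^sup>2) / ?Z \<partial>prior n \<pi>)"
    by (simp only: divide_ennreal_def mult_ac)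
  also have "\<dots> = (\<integral>\<^sup>+\<theta>. ennreal (likelihood n x \<theta>) * ennreal ((\<theta> i - t)\<^sup>2) \<partial>prior n \<pi>) / ?Z"
    by (rule nn_integral_divide) measurable
  also have "(\<integral>\<^sup>+\<theta>. ennreal (likelihood n x \<theta>) * ennreal ((\<theta> i - t)\<^sup>2) \<partial>prior n \<pi>) =
      ?a * (\<integral>\<^sup>+u. ennreal (weight \<pi> (x i) u) * ennreal (scale_risk t (x i) u) \<partial>lborel)"
    by (subst factor) (simp_all add: ennreal_mult[symmetric] prior1_square[OF \<pi>])
  also have "?Z = ?a * evidence \<pi> (x i)"
    using factor[of "\<lambda>_. 1"] by (simp add: prior1_evidence[OF \<pi>])
  also have "?a * (\<integral>\<^sup>+u. ennreal (weight \<pi> (x i) u) * ennreal (scale_risk t (x i) u) \<partial>lborel) /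
      (?a * evidence \<pi> (x i)) \<le> coord_risk \<pi> t (x i)"
    unfolding coord_risk_def by (rule ennreal_mult_divide_le[OF a])
  finally show ?thesis .
qed

lemma post_mean_square_le:
  assumes \<pi>: "mixing_density \<pi>" and i: "i \<in> {1..n}"
  shows "ennreal ((post_mean n \<pi> x i - t)\<^sup>2) \<le> coord_risk \<pi> t (x i)"
proof -
  interpret prob_space "posterior n \<pi> x" by (rule prob_space_posterior[OF \<pi>])
  have int: "integrable (posterior n \<pi> x) (\<lambda>\<theta>. \<theta> i)"
    by (rule post_mean_eq_shrinkage(1)[OF \<pi> i])
  note [measurable] = borel_measurable_integrable[OF int]
  have "ennreal ((post_mean n \<pi> x i - t)\<^sup>2) \<le> (\<integral>\<^sup>+\<theta>. ennreal ((\<theta> i - t)\<^sup>2) \<partial>posterior n \<pi> x)"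
  proof (cases "(\<integral>\<^sup>+\<theta>. ennreal ((\<theta> i - t)\<^sup>2) \<partial>posterior n \<pi> x) = \<infinity>")
    case False
    then have int2: "integrable (posterior n \<pi> x) (\<lambda>\<theta>. (\<theta> i - t)\<^sup>2)"
      by (intro integrableI_nonneg) (auto simp: top.not_eq_extremum)
    have "(expectation (\<lambda>\<theta>. \<theta> i - t))\<^sup>2 \<le> expectation (\<lambda>\<theta>. (\<theta> i - t)\<^sup>2)"
      using int int2 by (intro jensens_inequality[where I=UNIV and q="\<lambda>z. z\<^sup>2"]) (auto simp: convex_power2)
    also have "expectation (\<lambda>\<theta>. \<theta> i - t) = post_mean n \<pi> x i - t"
      using int by (simp add: post_mean_def prob_space)
    finally show ?thesis
      by (simp add: nn_integral_eq_integral[OF int2])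
  qed simp
  also have "\<dots> \<le> coord_risk \<pi> t (x i)" by (rule posterior_square_le[OF assms])
  finally show ?thesis .
qed

section \<open>From risk bounds to posterior contraction\<close>

lemma nn_integral_data_law_component:
  assumes "i \<in> {1..n}" and [measurable]: "f \<in> borel_measurable borel"
  shows "(\<integral>\<^sup>+x. f (x i) \<partial>data_law n \<theta>) = (\<integral>\<^sup>+y. f y \<partial>normal_law (\<theta> i) 1)"
proof -
  have "(\<integral>\<^sup>+y. f y \<partial>normal_law (\<theta> i) 1) =
      (\<integral>\<^sup>+y. f y \<partial>distr (data_law n \<theta>) (normal_law (\<theta> i) 1) (\<lambda>x. x i))"
    unfolding data_law_def
    by (subst distr_PiM_component) (use assms prob_space_normal_law in auto)
  also have "\<dots> = (\<integral>\<^sup>+x. f (x i) \<partial>data_law n \<theta>)"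
    unfolding data_law_def
    by (rule nn_integral_distr[OF measurable_component_singleton[OF assms(1)]])
      (simp cong: measurable_cong_sets)
  finally show ?thesis ..
qed

lemma sets_data_law: "sets (data_law n \<theta>) = sets (Rn n)"
  unfolding data_law_def by (intro sets_PiM_cong) auto

text \<open>Markov's inequality; the posterior second moments add up over the coordinates.\<close>

lemma posterior_tail_le:
  assumes \<pi>: "mixing_density \<pi>" and S: "S \<subseteq> {1..n}" and m: "0 < m"
  shows "emeasure (posterior n \<pi> x) {\<theta> \<in> space (Rn n). (\<Sum>i\<in>S. (\<theta> i - \<theta>0 i)\<^sup>2) > m} \<le>
    ennreal (1 / m) * (\<Sum>i\<in>S. coord_risk \<pi> (\<theta>0 i) (x i))"
proof -
  have "sets (posterior n \<pi> x) = sets (Rn n)"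
    by (simp add: posterior_def sets_prior[OF \<pi>])
  note [measurable_cong] = this and space = sets_eq_imp_space_eq[OF this]
  have [measurable]: "(\<lambda>\<theta>. \<theta> i) \<in> borel_measurable (posterior n \<pi> x)" if "i \<in> S" for i
    using measurable_component_singleton[of i "{1..n}" "\<lambda>_. borel"] S that by auto
  have "{\<theta> \<in> space (Rn n). (\<Sum>i\<in>S. (\<theta> i - \<theta>0 i)\<^sup>2) > m} \<subseteq>
      {\<theta> \<in> space (posterior n \<pi> x). 1 \<le> ennreal (1 / m) * (\<Sum>i\<in>S. ennreal ((\<theta> i - \<theta>0 i)\<^sup>2))}"
    using m by (auto simp: space sum_nonneg ennreal_mult[symmetric])
  then have "emeasure (posterior n \<pi> x) {\<theta> \<in> space (Rn n). (\<Sum>i\<in>S. (\<theta> i - \<theta>0 i)\<^sup>2) > m} \<le>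
      emeasure (posterior n \<pi> x)
        {\<theta> \<in> space (posterior n \<pi> x). 1 \<le> ennreal (1 / m) * (\<Sum>i\<in>S. ennreal ((\<theta> i - \<theta>0 i)\<^sup>2))}"
    by (rule emeasure_mono) measurable
  also have "\<dots> \<le> ennreal (1 / m) * (\<integral>\<^sup>+\<theta>. (\<Sum>i\<in>S. ennreal ((\<theta> i - \<theta>0 i)\<^sup>2)) *
      indicator (space (posterior n \<pi> x)) \<theta> \<partial>posterior n \<pi> x)"
    by (rule nn_integral_Markov_inequality) measurable
  also have "(\<integral>\<^sup>+\<theta>. (\<Sum>i\<in>S. ennreal ((\<theta> i - \<theta>0 i)\<^sup>2)) *
      indicator (space (posterior n \<pi> x)) \<theta> \<partial>posterior n \<pi> x) =
      (\<integral>\<^sup>+\<theta>. (\<Sum>i\<in>S. ennreal ((\<theta> i - \<theta>0 i)\<^sup>2)) \<partial>posterior n \<pi> x)"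
    by (intro nn_integral_cong) auto
  also have "\<dots> = (\<Sum>i\<in>S. \<integral>\<^sup>+\<theta>. ennreal ((\<theta> i - \<theta>0 i)\<^sup>2) \<partial>posterior n \<pi> x)"
    by (rule nn_integral_sum) measurable
  also have "\<dots> \<le> (\<Sum>i\<in>S. coord_risk \<pi> (\<theta>0 i) (x i))"
    using S by (intro sum_mono posterior_square_le[OF \<pi>]) auto
  finally show ?thesis by (simp add: mult_left_mono)
qed

lemma nn_integral_data_law_sum:
  assumes \<pi>: "mixing_density \<pi>" and S: "S \<subseteq> {1..n}"
  shows "(\<integral>\<^sup>+x. c * (\<Sum>i\<in>S. coord_risk \<pi> (\<theta>0 i) (x i)) \<partial>data_law n \<theta>0) =
    c * (\<Sum>i\<in>S. \<integral>\<^sup>+y. coord_risk \<pi> (\<theta>0 i) y \<partial>normal_law (\<theta>0 i) 1)"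
proof -
  note [measurable] = mixing_densityD(1)[OF \<pi>]
  note [measurable_cong] = sets_data_law
  have [measurable]: "(\<lambda>x. x i) \<in> borel_measurable (data_law n \<theta>0)" if "i \<in> S" for i
    using measurable_component_singleton[of i "{1..n}" "\<lambda>_. borel"] S that by auto
  have "(\<integral>\<^sup>+x. c * (\<Sum>i\<in>S. coord_risk \<pi> (\<theta>0 i) (x i)) \<partial>data_law n \<theta>0) =
      c * (\<Sum>i\<in>S. \<integral>\<^sup>+x. coord_risk \<pi> (\<theta>0 i) (x i) \<partial>data_law n \<theta>0)"
    by (subst nn_integral_cmult, measurable, subst nn_integral_sum, measurable)
  also have "(\<Sum>i\<in>S. \<integral>\<^sup>+x. coord_risk \<pi> (\<theta>0 i) (x i) \<partial>data_law n \<theta>0) =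
      (\<Sum>i\<in>S. \<integral>\<^sup>+y. coord_risk \<pi> (\<theta>0 i) y \<partial>normal_law (\<theta>0 i) 1)"
    using S by (intro sum.cong refl nn_integral_data_law_component) (auto simp: measurable_coord_risk)
  finally show ?thesis .
qed

text \<open>
  The reduction to a deterministic risk bound. Its index sets \<open>S n \<theta>0\<close> are the signal coordinates,
  the noise coordinates, or all of them.
\<close>

lemma contraction_of_coord_risk:
  fixes \<pi> :: "nat \<Rightarrow> real \<Rightarrow> real" and S :: "nat \<Rightarrow> (nat \<Rightarrow> real) \<Rightarrow> nat set" and r :: "nat \<Rightarrow> real"
  assumes dens: "\<forall>n\<ge>1. mixing_density (\<pi> n)"
    and M: "filterlim M at_top sequentially"
    and S: "\<And>n \<theta>0. S n \<theta>0 \<subseteq> {1..n}"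
    and C: "0 \<le> C" and r: "\<forall>\<^sub>F n in sequentially. 0 < r n"
    and risk: "\<forall>\<^sub>F n in sequentially. \<forall>\<theta>0\<in>sparse n (p n).
      (\<Sum>i\<in>S n \<theta>0. \<integral>\<^sup>+y. coord_risk (\<pi> n) (\<theta>0 i) y \<partial>normal_law (\<theta>0 i) 1) \<le> ennreal (C * r n)"
  shows "(\<lambda>n. sup_exp n (p n) (\<lambda>\<theta>0 x. emeasure (posterior n (\<pi> n) x)
        {\<theta> \<in> space (Rn n). (\<Sum>i\<in>S n \<theta>0. (\<theta> i - \<theta>0 i)\<^sup>2) > M n * r n})) \<longlonglongrightarrow> 0"
    and "\<forall>\<^sub>F n in sequentially. sup_exp n (p n) (\<lambda>\<theta>0 x. ennreal
        (\<Sum>i\<in>S n \<theta>0. (post_mean n (\<pi> n) x i - \<theta>0 i)\<^sup>2)) \<le> ennreal (C * r n)"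
proof -
  note \<pi> = dens[rule_format]
  have n1: "\<forall>\<^sub>F n in sequentially. 1 \<le> n" by (rule eventually_ge_at_top)
  have "\<forall>\<^sub>F n in sequentially. 0 < M n"
    using M by (simp add: filterlim_at_top_dense)
  with n1 r risk have "\<forall>\<^sub>F n in sequentially. sup_exp n (p n) (\<lambda>\<theta>0 x. emeasure (posterior n (\<pi> n) x)
        {\<theta> \<in> space (Rn n). (\<Sum>i\<in>S n \<theta>0. (\<theta> i - \<theta>0 i)\<^sup>2) > M n * r n}) \<le> ennreal (C / M n)"
  proof eventually_elim
    case (elim n)
    have m: "0 < M n * r n" using elim by simp
    show ?case unfolding sup_exp_def
    proof (rule SUP_least)
      fix \<theta>0 assume \<theta>0: "\<theta>0 \<in> sparse n (p n)"
      have "(\<integral>\<^sup>+x. emeasure (posterior n (\<pi> n) x)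
          {\<theta> \<in> space (Rn n). (\<Sum>i\<in>S n \<theta>0. (\<theta> i - \<theta>0 i)\<^sup>2) > M n * r n} \<partial>data_law n \<theta>0) \<le>
        (\<integral>\<^sup>+x. ennreal (1 / (M n * r n)) * (\<Sum>i\<in>S n \<theta>0. coord_risk (\<pi> n) (\<theta>0 i) (x i)) \<partial>data_law n \<theta>0)"
        by (intro nn_integral_mono posterior_tail_le \<pi> S m elim)
      also have "\<dots> \<le> ennreal (1 / (M n * r n)) * ennreal (C * r n)"
        unfolding nn_integral_data_law_sum[OF \<pi>[OF elim(1)] S]
        using elim(3) \<theta>0 by (intro mult_left_mono) auto
      also have "\<dots> = ennreal (C / M n)"
        using elim C by (simp add: ennreal_mult[symmetric])
      finally show "(\<integral>\<^sup>+x. emeasure (posterior n (\<pi> n) x)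
          {\<theta> \<in> space (Rn n). (\<Sum>i\<in>S n \<theta>0. (\<theta> i - \<theta>0 i)\<^sup>2) > M n * r n} \<partial>data_law n \<theta>0) \<le> ennreal (C / M n)" .
    qed
  qed
  moreover have "(\<lambda>n. C / M n) \<longlonglongrightarrow> 0"
    by (rule tendsto_divide_0[OF tendsto_const filterlim_at_top_imp_at_infinity[OF M]])
  then have "(\<lambda>n. ennreal (C / M n)) \<longlonglongrightarrow> ennreal 0"
    by (rule tendsto_ennrealI)
  ultimately show "(\<lambda>n. sup_exp n (p n) (\<lambda>\<theta>0 x. emeasure (posterior n (\<pi> n) x)
        {\<theta> \<in> space (Rn n). (\<Sum>i\<in>S n \<theta>0. (\<theta> i - \<theta>0 i)\<^sup>2) > M n * r n})) \<longlonglongrightarrow> 0"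
    unfolding ennreal_0 by (rule tendsto_sandwich[OF _ _ tendsto_const, rotated 1]) simp_all
  from n1 risk show "\<forall>\<^sub>F n in sequentially. sup_exp n (p n) (\<lambda>\<theta>0 x. ennreal
        (\<Sum>i\<in>S n \<theta>0. (post_mean n (\<pi> n) x i - \<theta>0 i)\<^sup>2)) \<le> ennreal (C * r n)"
  proof eventually_elim
    case (elim n)
    show ?case unfolding sup_exp_def
    proof (rule SUP_least)
      fix \<theta>0 assume \<theta>0: "\<theta>0 \<in> sparse n (p n)"
      have "ennreal (\<Sum>i\<in>S n \<theta>0. (post_mean n (\<pi> n) x i - \<theta>0 i)\<^sup>2) \<le>
          (\<Sum>i\<in>S n \<theta>0. coord_risk (\<pi> n) (\<theta>0 i) (x i))" for x
        using S[of n \<theta>0] post_mean_square_le[OF \<pi>[OF elim(1)]]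
        by (subst sum_ennreal[symmetric]) (simp, intro sum_mono, blast)
      then have "(\<integral>\<^sup>+x. ennreal (\<Sum>i\<in>S n \<theta>0. (post_mean n (\<pi> n) x i - \<theta>0 i)\<^sup>2) \<partial>data_law n \<theta>0) \<le>
        (\<integral>\<^sup>+x. 1 * (\<Sum>i\<in>S n \<theta>0. coord_risk (\<pi> n) (\<theta>0 i) (x i)) \<partial>data_law n \<theta>0)"
        unfolding mult_1 by (intro nn_integral_mono)
      also have "\<dots> \<le> ennreal (C * r n)"
        unfolding nn_integral_data_law_sum[OF \<pi>[OF elim(1)] S] using elim(2) \<theta>0 by simp
      finally show "(\<integral>\<^sup>+x. ennreal (\<Sum>i\<in>S n \<theta>0. (post_mean n (\<pi> n) x i - \<theta>0 i)\<^sup>2) \<partial>data_law n \<theta>0)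
          \<le> ennreal (C * r n)" .
    qed
  qed
qed

section \<open>Signal coordinates\<close>

lemma square_le_exp:
  assumes "0 \<le> (x :: real)"
  shows "x\<^sup>2 \<le> 2 * exp x"
  using exp_lower_Taylor_quadratic[OF assms] assms by simp

text \<open>
  Given the scale, the observation \<open>x\<close> is shrunk by \<open>x / (1 + u)\<close>. For \<open>\<bar>x\<bar> \<le> b u1\<close> the
  square of this is trivially \<open>O(b\<^sup>2)\<close>. For larger \<open>\<bar>x\<bar>\<close>, the scales that shrink by more than
  \<open>L b\<close> have a likelihood factor below \<open>exp (- L b \<bar>x\<bar> / 2)\<close>, which is negligible against the
  evidence collected by the scales in \<open>[\<bar>x\<bar>, 2 \<bar>x\<bar>]\<close>.
\<close>

lemma shrinkage_gap_le:
  assumes \<pi>: "mixing_density \<pi>" and b: "1 \<le> b"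
    and K: "0 \<le> K" and b': "0 \<le> b'" and u1: "1 \<le> u1" and C': "0 < C'"
    and lower: "\<And>u. u1 \<le> u \<Longrightarrow> exp (- K * b\<^sup>2) * exp (- b' * u) \<le> C' * \<pi> u"
  shows "(\<integral>\<^sup>+u. ennreal (weight \<pi> x u) * ennreal ((x / (1 + u))\<^sup>2) \<partial>lborel) \<le>
    ennreal ((u1\<^sup>2 + (2 * (K + 2 * b' + 2))\<^sup>2 + 4 * C') * b\<^sup>2) * evidence \<pi> x"
proof -
  note [measurable] = mixing_densityD(1)[OF \<pi>]
  note nn = mixing_densityD(2)[OF \<pi>] and neg = mixing_densityD(3)[OF \<pi>]
  \<comment> \<open>The constant makes \<open>L b \<bar>x\<bar> / 2\<close> at least \<open>K b\<^sup>2 + (2 b' + 2) \<bar>x\<bar>\<close> when \<open>1 \<le> b \<le> \<bar>x\<bar>\<close>.\<close>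
  define L where "L = 2 * (K + 2 * b' + 2)"
  define F where "F = (\<integral>\<^sup>+u. ennreal (weight \<pi> x u) * ennreal ((x / (1 + u))\<^sup>2) \<partial>lborel)"
  have L: "0 < L" using K b' by (simp add: L_def)
  show ?thesis
  proof (cases "\<bar>x\<bar> \<le> b * u1")
    case True
    have "F \<le> (\<integral>\<^sup>+u. ennreal (u1\<^sup>2 * b\<^sup>2) * ennreal (weight \<pi> x u) \<partial>lborel)"
      unfolding F_def
    proof (rule nn_integral_mono)
      fix u
      show "ennreal (weight \<pi> x u) * ennreal ((x / (1 + u))\<^sup>2) \<le> ennreal (u1\<^sup>2 * b\<^sup>2) * ennreal (weight \<pi> x u)"
      proof (cases "u < 0")
        case False
        have "\<bar>x / (1 + u)\<bar> \<le> \<bar>x\<bar>" using False mult_left_mono[of 1 "1 + u" "\<bar>x\<bar>"] by (simp add: divide_simps)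
        also note True
        finally have "(x / (1 + u))\<^sup>2 \<le> (b * u1)\<^sup>2"
          by (rule abs_le_square_iff[THEN iffD1, OF order_trans]) (use b u1 in simp)
        then have "ennreal ((x / (1 + u))\<^sup>2) \<le> ennreal (u1\<^sup>2 * b\<^sup>2)"
          by (intro ennreal_leI) (simp add: power_mult_distrib mult.commute)
        then show ?thesis by (subst mult.commute) (rule mult_right_mono, simp_all)
      qed (simp add: weight_def neg)
    qed
    also have "\<dots> = ennreal (u1\<^sup>2 * b\<^sup>2) * evidence \<pi> x"
      by (simp add: nn_integral_cmult evidence_def)
    also have "\<dots> \<le> ennreal ((u1\<^sup>2 + L\<^sup>2 + 4 * C') * b\<^sup>2) * evidence \<pi> x"
      using C' by (intro mult_right_mono ennreal_leI) auto
    finally show ?thesis by (simp add: F_def L_def)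
  next
    case False
    have "b * 1 \<le> b * u1" "1 * u1 \<le> b * u1"
      using b u1 by (auto intro: mult_left_mono mult_right_mono)
    then have xb: "b \<le> \<bar>x\<bar>" and xu: "u1 \<le> \<bar>x\<bar>" and x1: "1 \<le> \<bar>x\<bar>"
      using False b u1 by linarith+
    \<comment> \<open>\<open>e\<close> bounds what a unit of prior mass on the small scales contributes;
      \<open>d\<close> bounds the weight from below on \<open>[\<bar>x\<bar>, 2 \<bar>x\<bar>]\<close>.\<close>
    define e where "e = x\<^sup>2 * exp (- (L * b * \<bar>x\<bar> / 2)) / sqrt (2 * pi)"
    define d where "d = exp (- K * b\<^sup>2) * exp (- b' * (2 * \<bar>x\<bar>)) / C' *
      (exp (- (\<bar>x\<bar> / 2)) / sqrt (2 * pi * (1 + 2 * \<bar>x\<bar>)))"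
    have e0: "0 \<le> e" and d0: "0 \<le> d" using C' by (simp_all add: e_def d_def)
    have nd: "normal_density 0 (sqrt (1 + u)) x = exp (- (x\<^sup>2 / (2 * (1 + u)))) / sqrt (2 * pi * (1 + u))"
      if "0 \<le> u" for u
      using that by (simp add: normal_density_def)
    have "F \<le> (\<integral>\<^sup>+u. ennreal (L\<^sup>2 * b\<^sup>2) * ennreal (weight \<pi> x u) + ennreal e * ennreal (\<pi> u) \<partial>lborel)"
      unfolding F_def
    proof (rule nn_integral_mono)
      fix u
      consider "u < 0" | "0 \<le> u" "\<bar>x\<bar> \<le> L * b * (1 + u)" | "0 \<le> u" "L * b * (1 + u) < \<bar>x\<bar>" by linarith
      then show "ennreal (weight \<pi> x u) * ennreal ((x / (1 + u))\<^sup>2) \<le>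
          ennreal (L\<^sup>2 * b\<^sup>2) * ennreal (weight \<pi> x u) + ennreal e * ennreal (\<pi> u)"
      proof cases
        case 1
        then show ?thesis by (simp add: weight_def neg)
      next
        case 2
        then have "\<bar>x / (1 + u)\<bar> \<le> L * b" by (simp add: divide_simps)
        then have "(x / (1 + u))\<^sup>2 \<le> (L * b)\<^sup>2"
          by (rule abs_le_square_iff[THEN iffD1, OF order_trans]) (use b L in simp)
        then have "ennreal ((x / (1 + u))\<^sup>2) \<le> ennreal (L\<^sup>2 * b\<^sup>2)"
          by (intro ennreal_leI) (simp add: power_mult_distrib)
        then have "ennreal ((x / (1 + u))\<^sup>2) * ennreal (weight \<pi> x u) \<le>
            ennreal (L\<^sup>2 * b\<^sup>2) * ennreal (weight \<pi> x u)"
          by (rule mult_right_mono) simp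
        then show ?thesis by (subst mult.commute) (rule add_increasing2, simp_all)
      next
        case 3
        have "x\<^sup>2 / (1 + u) = \<bar>x\<bar> * \<bar>x\<bar> / (1 + u)" by (simp add: power2_eq_square)
        also have "\<dots> \<ge> L * b * (1 + u) * \<bar>x\<bar> / (1 + u)"
          using 3 by (intro divide_right_mono mult_right_mono) auto
        finally have "L * b * \<bar>x\<bar> \<le> x\<^sup>2 / (1 + u)" using 3 by simp
        then have "L * b * \<bar>x\<bar> / 2 \<le> x\<^sup>2 / (1 + u) / 2" by (rule divide_right_mono) simp
        also have "\<dots> = x\<^sup>2 / (2 * (1 + u))" by (simp only: divide_divide_eq_left mult.commute)
        finally have "L * b * \<bar>x\<bar> / 2 \<le> x\<^sup>2 / (2 * (1 + u))" .
        moreover have "sqrt (2 * pi) \<le> sqrt (2 * pi * (1 + u))" using 3 by simp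
        ultimately have "normal_density 0 (sqrt (1 + u)) x \<le> exp (- (L * b * \<bar>x\<bar> / 2)) / sqrt (2 * pi)"
          unfolding nd[OF 3(1)] by (intro frac_le) auto
        moreover have "(x / (1 + u))\<^sup>2 \<le> x\<^sup>2"
          using 3 by (simp add: power_divide divide_simps mult_le_cancel_left1)
        ultimately have "normal_density 0 (sqrt (1 + u)) x * (x / (1 + u))\<^sup>2 \<le>
            exp (- (L * b * \<bar>x\<bar> / 2)) / sqrt (2 * pi) * x\<^sup>2"
          by (intro mult_mono) auto
        then have "\<pi> u * (normal_density 0 (sqrt (1 + u)) x * (x / (1 + u))\<^sup>2) \<le>
            \<pi> u * (exp (- (L * b * \<bar>x\<bar> / 2)) / sqrt (2 * pi) * x\<^sup>2)"
          by (rule mult_left_mono[OF _ nn])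
        then have "weight \<pi> x u * (x / (1 + u))\<^sup>2 \<le> e * \<pi> u"
          by (simp add: weight_def e_def mult_ac)
        then have "ennreal (weight \<pi> x u * (x / (1 + u))\<^sup>2) \<le> ennreal (e * \<pi> u)" by (rule ennreal_leI)
        then show ?thesis
          using e0 nn[of u] weight_nonneg[OF \<pi>, of x u] by (simp add: ennreal_mult add_increasing)
      qed
    qed
    also have "\<dots> = ennreal (L\<^sup>2 * b\<^sup>2) * evidence \<pi> x + ennreal e"
      using mixing_densityD(4)[OF \<pi>] by (simp add: nn_integral_add nn_integral_cmult evidence_def)
    also have "ennreal e \<le> ennreal (4 * C' * (d * \<bar>x\<bar>))"
    proof (rule ennreal_leI)
      have "1 + 2 * \<bar>x\<bar> \<le> (2 * \<bar>x\<bar>)\<^sup>2"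
        using x1 mult_mono[of 1 "\<bar>x\<bar>" 1 "\<bar>x\<bar>"] mult_left_mono[of 1 "\<bar>x\<bar>" "\<bar>x\<bar>"]
        by (simp add: power2_eq_square)
      then have "sqrt (1 + 2 * \<bar>x\<bar>) \<le> 2 * \<bar>x\<bar>" by (rule real_le_lsqrt[rotated 1]) simp
      moreover have q: "0 < sqrt (1 + 2 * \<bar>x\<bar>)" by simp
      ultimately have s: "1 \<le> 2 * \<bar>x\<bar> / sqrt (1 + 2 * \<bar>x\<bar>)" by (simp only: le_divide_eq_1_pos)
      \<comment> \<open>The exponents in \<open>e\<close> and \<open>d\<close>; a factor \<open>exp \<bar>x\<bar>\<close> is spent on the \<open>x\<^sup>2\<close> in \<open>e\<close>.\<close>
      have "K * b\<^sup>2 \<le> K * (b * \<bar>x\<bar>)"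
        using K b xb by (simp add: power2_eq_square mult_left_mono)
      moreover have "(2 * b' + 2) * \<bar>x\<bar> \<le> (2 * b' + 2) * (b * \<bar>x\<bar>)"
        using b' b x1 by (intro mult_left_mono) (auto simp: mult_le_cancel_right1)
      ultimately have "\<bar>x\<bar> - L * b * \<bar>x\<bar> / 2 \<le> - K * b\<^sup>2 - b' * (2 * \<bar>x\<bar>) - \<bar>x\<bar> / 2"
        using x1 by (simp add: L_def algebra_simps)
      then have ex: "exp (\<bar>x\<bar> - L * b * \<bar>x\<bar> / 2) \<le> exp (- K * b\<^sup>2 - b' * (2 * \<bar>x\<bar>) - \<bar>x\<bar> / 2)" by simp
      have "x\<^sup>2 * exp (- (L * b * \<bar>x\<bar> / 2)) \<le> 2 * exp \<bar>x\<bar> * exp (- (L * b * \<bar>x\<bar> / 2))"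
        using square_le_exp[of "\<bar>x\<bar>"] by (intro mult_right_mono) auto
      also have "\<dots> = 2 * exp (\<bar>x\<bar> - L * b * \<bar>x\<bar> / 2)" by (simp add: mult.assoc mult_exp_exp)
      also have "\<dots> \<le> 2 * exp (- K * b\<^sup>2 - b' * (2 * \<bar>x\<bar>) - \<bar>x\<bar> / 2)" using ex by simp
      also have "\<dots> \<le> 2 * exp (- K * b\<^sup>2 - b' * (2 * \<bar>x\<bar>) - \<bar>x\<bar> / 2) * (2 * \<bar>x\<bar> / sqrt (1 + 2 * \<bar>x\<bar>))"
        using s by (subst mult_le_cancel_left1) auto
      finally have "e \<le> 2 * exp (- K * b\<^sup>2 - b' * (2 * \<bar>x\<bar>) - \<bar>x\<bar> / 2) * (2 * \<bar>x\<bar> / sqrt (1 + 2 * \<bar>x\<bar>)) / sqrt (2 * pi)"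
        unfolding e_def by (rule divide_right_mono) simp
      also have "\<dots> = 4 * C' * (d * \<bar>x\<bar>)"
      proof -
        have "exp (- K * b\<^sup>2 - b' * (2 * \<bar>x\<bar>) - \<bar>x\<bar> / 2) =
            exp (- K * b\<^sup>2) * exp (- b' * (2 * \<bar>x\<bar>)) * exp (- (\<bar>x\<bar> / 2))"
          by (simp add: mult_exp_exp)
        then show ?thesis
          using C' q unfolding d_def real_sqrt_mult[of "2 * pi"] by (simp add: field_simps)
      qed
      finally show "e \<le> 4 * C' * (d * \<bar>x\<bar>)" .
    qed
    also have "\<dots> \<le> ennreal (4 * C') * evidence \<pi> x"
    proof -
      have "ennreal (d * \<bar>x\<bar>) = (\<integral>\<^sup>+u. ennreal d * indicator {\<bar>x\<bar>..2 * \<bar>x\<bar>} u \<partial>lborel)"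
        using d0 by (simp add: nn_integral_cmult_indicator ennreal_mult)
      also have "\<dots> \<le> evidence \<pi> x"
        unfolding evidence_def
      proof (rule nn_integral_mono)
        fix u
        have "d \<le> weight \<pi> x u" if u: "\<bar>x\<bar> \<le> u" "u \<le> 2 * \<bar>x\<bar>"
        proof -
          have "exp (- K * b\<^sup>2) * exp (- b' * (2 * \<bar>x\<bar>)) \<le> exp (- K * b\<^sup>2) * exp (- b' * u)"
            using u b' by (intro mult_left_mono) (auto intro: mult_left_mono)
          also have "\<dots> \<le> C' * \<pi> u" using u xu by (intro lower) auto
          finally have 1: "exp (- K * b\<^sup>2) * exp (- b' * (2 * \<bar>x\<bar>)) / C' \<le> \<pi> u"
            using C' by (simp add: divide_simps mult_ac)
          have "x\<^sup>2 \<le> \<bar>x\<bar> * (1 + u)"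
            using u mult_left_mono[of "\<bar>x\<bar>" "1 + u" "\<bar>x\<bar>"] by (simp add: power2_eq_square)
          then have "x\<^sup>2 / (2 * (1 + u)) \<le> \<bar>x\<bar> / 2"
            using u by (simp add: divide_simps) (simp add: algebra_simps)
          then have "exp (- (\<bar>x\<bar> / 2)) / sqrt (2 * pi * (1 + 2 * \<bar>x\<bar>)) \<le> normal_density 0 (sqrt (1 + u)) x"
            using u by (subst nd) (auto intro!: frac_le)
          with 1 show ?thesis
            unfolding d_def weight_def using nn by (intro mult_mono) auto
        qed
        then show "ennreal d * indicator {\<bar>x\<bar>..2 * \<bar>x\<bar>} u \<le> ennreal (weight \<pi> x u)"
          by (auto simp: indicator_def intro!: ennreal_leI)
      qed
      finally show ?thesis
        using C' d0 by (simp add: ennreal_mult mult_left_mono)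
    qed
    also have "ennreal (L\<^sup>2 * b\<^sup>2) * evidence \<pi> x + ennreal (4 * C') * evidence \<pi> x =
        ennreal (L\<^sup>2 * b\<^sup>2 + 4 * C') * evidence \<pi> x"
      using C' by (simp add: distrib_right)
    also have "\<dots> \<le> ennreal ((u1\<^sup>2 + L\<^sup>2 + 4 * C') * b\<^sup>2) * evidence \<pi> x"
      using C' b by (intro mult_right_mono ennreal_leI) (auto simp: distrib_right mult_le_cancel_left1 add_increasing)
    finally show ?thesis by (simp add: F_def L_def add_left_mono)
  qed
qed

lemma diff_square_le: "(a - b)\<^sup>2 \<le> 2 * a\<^sup>2 + 2 * (b :: real)\<^sup>2"
  using zero_le_power2[of "a + b"] by (simp add: power2_sum power2_diff)

text \<open>
  From \<open>u / (1 + u) * x - t = (x - t) - x / (1 + u)\<close>: the risk is controlled by the noise \<open>x - t\<close>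
  in the observation and by the amount of shrinkage.
\<close>

lemma coord_risk_le_of_gap:
  assumes \<pi>: "mixing_density \<pi>" and A: "0 \<le> A"
    and gap: "(\<integral>\<^sup>+u. ennreal (weight \<pi> x u) * ennreal ((x / (1 + u))\<^sup>2) \<partial>lborel) \<le> ennreal A * evidence \<pi> x"
  shows "coord_risk \<pi> t x \<le> ennreal (1 + 2 * A) + ennreal 2 * ennreal ((x - t)\<^sup>2)"
proof -
  note [measurable] = mixing_densityD(1)[OF \<pi>]
  let ?c = "ennreal (1 + 2 * (x - t)\<^sup>2)"
  have "(\<integral>\<^sup>+u. ennreal (weight \<pi> x u) * ennreal (scale_risk t x u) \<partial>lborel) \<le>
      (\<integral>\<^sup>+u. ?c * ennreal (weight \<pi> x u) + 2 * (ennreal (weight \<pi> x u) * ennreal ((x / (1 + u))\<^sup>2)) \<partial>lborel)"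
  proof (rule nn_integral_mono)
    fix u
    show "ennreal (weight \<pi> x u) * ennreal (scale_risk t x u) \<le>
        ?c * ennreal (weight \<pi> x u) + 2 * (ennreal (weight \<pi> x u) * ennreal ((x / (1 + u))\<^sup>2))"
    proof (cases "u < 0")
      case False
      have eq: "u / (1 + u) * x - t = (x - t) - x / (1 + u)" using False by (simp add: divide_simps) (simp add: algebra_simps)
      have "(u / (1 + u) * x - t)\<^sup>2 \<le> 2 * (x - t)\<^sup>2 + 2 * (x / (1 + u))\<^sup>2"
        unfolding eq by (rule diff_square_le)
      moreover have "u / (1 + u) \<le> 1" using False by simp
      ultimately have "scale_risk t x u \<le> (1 + 2 * (x - t)\<^sup>2) + 2 * (x / (1 + u))\<^sup>2"
        by (simp add: scale_risk_def)
      then have "weight \<pi> x u * scale_risk t x u \<le> weight \<pi> x u * ((1 + 2 * (x - t)\<^sup>2) + 2 * (x / (1 + u))\<^sup>2)"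
        by (intro mult_left_mono weight_nonneg[OF \<pi>])
      then have "ennreal (weight \<pi> x u * scale_risk t x u) \<le>
          ennreal ((1 + 2 * (x - t)\<^sup>2) * weight \<pi> x u + 2 * (weight \<pi> x u * (x / (1 + u))\<^sup>2))"
        by (intro ennreal_leI) (simp add: algebra_simps)
      also have "\<dots> = ?c * ennreal (weight \<pi> x u) + 2 * (ennreal (weight \<pi> x u) * ennreal ((x / (1 + u))\<^sup>2))"
        by (simp add: ennreal_mult weight_nonneg[OF \<pi>])
      finally show ?thesis by (simp add: ennreal_mult' weight_nonneg[OF \<pi>])
    qed (simp add: weight_def mixing_densityD(3)[OF \<pi>])
  qed
  also have "\<dots> = ?c * evidence \<pi> x +
      2 * (\<integral>\<^sup>+u. ennreal (weight \<pi> x u) * ennreal ((x / (1 + u))\<^sup>2) \<partial>lborel)"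
    by (simp add: nn_integral_add nn_integral_cmult evidence_def)
  also have "\<dots> \<le> ?c * evidence \<pi> x + 2 * (ennreal A * evidence \<pi> x)"
    by (intro add_left_mono mult_left_mono gap) simp
  also have "\<dots> = (ennreal (1 + 2 * A) + ennreal 2 * ennreal ((x - t)\<^sup>2)) * evidence \<pi> x"
    using A by (simp add: ennreal_mult distrib_right mult.assoc add_ac)
  finally show ?thesis
    unfolding coord_risk_def by (rule ennreal_divide_le_of_le_mult)
qed

text \<open>The bound does not depend on \<open>t\<close>, however large the signal may be.\<close>

lemma signal_risk_le:
  assumes \<pi>: "mixing_density \<pi>" and b: "1 \<le> b"
    and K: "0 \<le> K" and b': "0 \<le> b'" and u1: "1 \<le> u1" and C': "0 < C'"
    and lower: "\<And>u. u1 \<le> u \<Longrightarrow> exp (- K * b\<^sup>2) * exp (- b' * u) \<le> C' * \<pi> u"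
  shows "(\<integral>\<^sup>+x. coord_risk \<pi> t x \<partial>normal_law t 1) \<le>
    ennreal ((3 + 2 * (u1\<^sup>2 + (2 * (K + 2 * b' + 2))\<^sup>2 + 4 * C')) * b\<^sup>2)"
proof -
  note [measurable] = mixing_densityD(1)[OF \<pi>]
  interpret prob_space "normal_law t 1" by (rule prob_space_normal_law)
  define A where "A = u1\<^sup>2 + (2 * (K + 2 * b' + 2))\<^sup>2 + 4 * C'"
  have A: "0 \<le> A" using C' by (simp add: A_def)
  have "(\<integral>\<^sup>+x. coord_risk \<pi> t x \<partial>normal_law t 1) \<le>
      (\<integral>\<^sup>+x. ennreal (1 + 2 * (A * b\<^sup>2)) + ennreal 2 * ennreal ((x - t)\<^sup>2) \<partial>normal_law t 1)"
    by (intro nn_integral_mono coord_risk_le_of_gap[OF \<pi>]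
        shrinkage_gap_le[OF \<pi> b K b' u1 C' lower, folded A_def]) (use A in simp_all)
  also have "\<dots> = ennreal (1 + 2 * (A * b\<^sup>2)) + ennreal 2 * ennreal 1"
    using emeasure_space_1 nn_integral_normal_law_square[of 1 t t]
    by (subst nn_integral_add) (simp_all add: nn_integral_cmult cong: measurable_cong_sets)
  also have "\<dots> = ennreal (3 + 2 * A * b\<^sup>2)"
    using A by (subst ennreal_mult[symmetric], simp, simp, subst ennreal_plus[symmetric]) simp_all
  also have "\<dots> \<le> ennreal ((3 + 2 * A) * b\<^sup>2)"
    using b by (intro ennreal_leI) (simp add: distrib_right)
  finally show ?thesis by (simp add: A_def)
qed

section \<open>Noise coordinates\<close>

text \<open>
  The function \<open>x\<^sup>2 - 1\<close> times the normal density has the elementary primitive \<open>- x\<close> times the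
  density, and on the tail it dominates \<open>(1 + x\<^sup>2) / 3\<close>.
\<close>

lemma std_normal_tail:
  assumes B: "sqrt 2 \<le> B"
  shows "(\<integral>\<^sup>+x. ennreal (std_normal_density x * (1 + x\<^sup>2)) * indicator {x. B < \<bar>x\<bar>} x \<partial>lborel) \<le>
    ennreal (6 * B * std_normal_density B)"
proof -
  let ?g = "\<lambda>x :: real. std_normal_density x * (3 * (x\<^sup>2 - 1))"
  have B0: "0 < B" using B by (rule less_le_trans[rotated]) simp
  have two: "2 \<le> x\<^sup>2" if "B \<le> x" for x
    using that B by (intro sqrt_le_D) simp
  define c :: real where "c = 1 / sqrt (2 * pi)"
  have dens: "std_normal_density x = c * exp (- (x\<^sup>2 / 2))" for x
    by (simp add: std_normal_density_def c_def)
  have DERIV: "((\<lambda>x. - 3 * x * std_normal_density x) has_real_derivative ?g x) (at x)" for x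
    unfolding dens
    by (auto intro!: derivative_eq_intros simp: algebra_simps power2_eq_square)
  \<comment> \<open>The primitive is \<open>O(1 / x)\<close>, since \<open>exp (- y) \<le> 1 / y\<close> for \<open>y > 0\<close>.\<close>
  have lim: "((\<lambda>x. - 3 * x * std_normal_density x) \<longlongrightarrow> 0) at_top"
  proof (rule Lim_null_comparison)
    show "\<forall>\<^sub>F x in at_top. norm (- 3 * x * std_normal_density x) \<le> 6 / x"
      using eventually_gt_at_top[of 0]
    proof eventually_elim
      case (elim x)
      have "x\<^sup>2 / 2 \<le> exp (x\<^sup>2 / 2)" using exp_ge_add_one_self[of "x\<^sup>2 / 2"] by linarith
      then have *: "x * exp (- (x\<^sup>2 / 2)) \<le> 2 / x"
        using elim by (simp add: exp_minus divide_simps power2_eq_square mult_ac)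
      have "std_normal_density x \<le> exp (- (x\<^sup>2 / 2))"
        using pi_gt3 by (simp add: std_normal_density_def divide_simps real_le_rsqrt)
      then have "x * std_normal_density x \<le> x * exp (- (x\<^sup>2 / 2))"
        using elim by (intro mult_left_mono) auto
      with * have "x * std_normal_density x \<le> 2 / x" by linarith
      then show ?case using elim by (simp add: abs_mult)
    qed
    show "((\<lambda>x :: real. 6 / x) \<longlongrightarrow> 0) at_top"
      by (rule tendsto_divide_0[OF tendsto_const filterlim_at_top_imp_at_infinity[OF filterlim_ident]])
  qed
  have "(\<integral>\<^sup>+x. ennreal (?g x) * indicator {B..} x \<partial>lborel) = ennreal (0 - (- 3 * B * std_normal_density B))"
    by (rule nn_integral_FTC_atLeast[OF _ DERIV _ lim]) (use two in force)+
  then have half: "(\<integral>\<^sup>+x. ennreal (?g x) * indicator {B..} x \<partial>lborel) = ennreal (3 * B * std_normal_density B)"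
    by simp
  have "(\<integral>\<^sup>+x. ennreal (?g x) * indicator {..-B} x \<partial>lborel) =
      (\<integral>\<^sup>+x. ennreal (?g x) * indicator {B..} x \<partial>lborel)"
    by (subst nn_integral_real_affine[where c="-1" and t=0])
      (auto intro!: nn_integral_cong simp: normal_density_def indicator_def)
  note half' = this[unfolded half]
  have "(\<integral>\<^sup>+x. ennreal (std_normal_density x * (1 + x\<^sup>2)) * indicator {x. B < \<bar>x\<bar>} x \<partial>lborel) \<le>
      (\<integral>\<^sup>+x. ennreal (?g x) * indicator {B..} x + ennreal (?g x) * indicator {..-B} x \<partial>lborel)"
  proof (rule nn_integral_mono)
    fix x
    have "ennreal (std_normal_density x * (1 + x\<^sup>2)) \<le> ennreal (?g x)" if "B < \<bar>x\<bar>"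
      using two[of "\<bar>x\<bar>"] that by (intro ennreal_leI mult_left_mono) auto
    then show "ennreal (std_normal_density x * (1 + x\<^sup>2)) * indicator {x. B < \<bar>x\<bar>} x \<le>
        ennreal (?g x) * indicator {B..} x + ennreal (?g x) * indicator {..-B} x"
      using B0 by (auto simp: indicator_def)
  qed
  also have "\<dots> = ennreal (3 * B * std_normal_density B) + ennreal (3 * B * std_normal_density B)"
    by (subst nn_integral_add) (simp_all only: half half', measurable)
  also have "\<dots> = ennreal (6 * B * std_normal_density B)"
    using B0 by (simp add: ennreal_plus[symmetric] del: ennreal_plus)
  finally show ?thesis .
qed

text \<open>Scales in \<open>[0, 1]\<close> inflate the variance of the observation by a factor of at most \<open>2\<close>.\<close>

lemma evidence_ge:
  assumes \<pi>: "mixing_density \<pi>" and c: "0 \<le> c"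
    and mass: "ennreal c \<le> (\<integral>\<^sup>+u. ennreal (\<pi> u) * indicator {0..1} u \<partial>lborel)"
  shows "ennreal (std_normal_density x / sqrt 2 * c) \<le> evidence \<pi> x"
proof -
  note [measurable] = mixing_densityD(1)[OF \<pi>]
  have "ennreal (std_normal_density x / sqrt 2 * c) = ennreal (std_normal_density x / sqrt 2) * ennreal c"
    using c by (intro ennreal_mult) auto
  also have "\<dots> \<le> ennreal (std_normal_density x / sqrt 2) * (\<integral>\<^sup>+u. ennreal (\<pi> u) * indicator {0..1} u \<partial>lborel)"
    by (intro mult_left_mono mass) simp
  also have "\<dots> = (\<integral>\<^sup>+u. ennreal (std_normal_density x / sqrt 2) * (ennreal (\<pi> u) * indicator {0..1} u) \<partial>lborel)"
    by (rule nn_integral_cmult[symmetric]) measurable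
  also have "\<dots> \<le> evidence \<pi> x"
    unfolding evidence_def
  proof (rule nn_integral_mono)
    fix u
    have "std_normal_density x / sqrt 2 * \<pi> u \<le> weight \<pi> x u" if u: "0 \<le> u" "u \<le> 1"
    proof -
      have "x\<^sup>2 / (2 * (1 + u)) \<le> x\<^sup>2 / 2"
        using u by (intro divide_left_mono) auto
      moreover have "sqrt (2 * pi * (1 + u)) \<le> sqrt (2 * pi) * sqrt 2"
        unfolding real_sqrt_mult[symmetric] using u by (intro real_sqrt_le_mono mult_left_mono) auto
      ultimately have "exp (- (x\<^sup>2 / 2)) / (sqrt (2 * pi) * sqrt 2) \<le>
          exp (- (x\<^sup>2 / (2 * (1 + u)))) / sqrt (2 * pi * (1 + u))"
        using u by (intro frac_le) auto
      then have "std_normal_density x / sqrt 2 \<le> normal_density 0 (sqrt (1 + u)) x"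
        using u by (simp add: normal_density_def)
      then show ?thesis
        unfolding weight_def using mixing_densityD(2)[OF \<pi>, of u]
        by (subst mult.commute) (rule mult_left_mono)
    qed
    then show "ennreal (std_normal_density x / sqrt 2) * (ennreal (\<pi> u) * indicator {0..1} u) \<le> ennreal (weight \<pi> x u)"
      by (auto simp: indicator_def ennreal_mult[symmetric] mixing_densityD(2)[OF \<pi>] intro!: ennreal_leI)
  qed
  finally show ?thesis .
qed

text \<open>
  The bound \<open>u\<close> is the prior second moment of a coordinate with scale \<open>u\<close>, obtained by ignoring the
  truncation. The bound \<open>b\<^sup>3 / sqrt u\<close> uses that the density of the observation is at most
  \<open>1 / sqrt (2 u)\<close>, while the risk is \<open>O(b\<^sup>2)\<close> on an interval of length \<open>O(b)\<close>.
\<close>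

lemma scale_risk_truncated_le:
  assumes u: "0 < u" and b: "1 \<le> b"
  shows "(\<integral>\<^sup>+x. ennreal (normal_density 0 (sqrt (1 + u)) x * scale_risk 0 x u) *
      indicator {x. \<bar>x\<bar> \<le> sqrt 2 * b} x \<partial>lborel) \<le> ennreal (6 * min u (b ^ 3 / sqrt u))"
    (is "?I \<le> _")
proof -
  define k where "k = u / (1 + u)"
  have k: "0 \<le> k" "k \<le> 1" using u by (simp_all add: k_def)
  have sr: "scale_risk 0 x u = k + k\<^sup>2 * x\<^sup>2" for x
    by (simp add: scale_risk_def k_def power_mult_distrib power_divide)
  have "?I \<le> (\<integral>\<^sup>+x. ennreal k * ennreal (normal_density 0 (sqrt (1 + u)) x) +
      ennreal (k\<^sup>2) * ennreal (normal_density 0 (sqrt (1 + u)) x * (x - 0)\<^sup>2) \<partial>lborel)"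
  proof (rule nn_integral_mono)
    fix x
    have "ennreal (normal_density 0 (sqrt (1 + u)) x * scale_risk 0 x u) =
        ennreal k * ennreal (normal_density 0 (sqrt (1 + u)) x) +
        ennreal (k\<^sup>2) * ennreal (normal_density 0 (sqrt (1 + u)) x * (x - 0)\<^sup>2)"
      using k by (simp add: sr ennreal_mult[symmetric] ennreal_plus[symmetric] distrib_left mult_ac del: ennreal_plus)
    then show "ennreal (normal_density 0 (sqrt (1 + u)) x * scale_risk 0 x u) * indicator {x. \<bar>x\<bar> \<le> sqrt 2 * b} x \<le>
        ennreal k * ennreal (normal_density 0 (sqrt (1 + u)) x) +
        ennreal (k\<^sup>2) * ennreal (normal_density 0 (sqrt (1 + u)) x * (x - 0)\<^sup>2)"
      by (simp add: indicator_def)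
  qed
  also have "\<dots> = ennreal k * 1 + ennreal (k\<^sup>2) * ennreal (1 + u)"
    using u nn_integral_normal_square[of "sqrt (1 + u)" 0 0]
    by (subst nn_integral_add) (simp_all add: nn_integral_cmult nn_integral_normal_density)
  also have "\<dots> = ennreal (k + k\<^sup>2 * (1 + u))"
    using k u ennreal_plus[of k "k\<^sup>2 * (1 + u)"] ennreal_mult[of "k\<^sup>2" "1 + u"]
    by (simp del: ennreal_plus)
  also have "k + k\<^sup>2 * (1 + u) = u"
    using u by (simp add: k_def power2_eq_square divide_simps) (simp add: algebra_simps)
  also have "ennreal u \<le> ennreal (6 * u)" using u by (intro ennreal_leI) simp
  finally have 1: "?I \<le> ennreal (6 * u)" .
  have "?I \<le> (\<integral>\<^sup>+x. ennreal (3 * b\<^sup>2 / sqrt (2 * u)) * indicator {- (sqrt 2 * b)..sqrt 2 * b} x \<partial>lborel)"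
  proof (rule nn_integral_mono)
    fix x
    have "normal_density 0 (sqrt (1 + u)) x * scale_risk 0 x u \<le> 3 * b\<^sup>2 / sqrt (2 * u)" if x: "\<bar>x\<bar> \<le> sqrt 2 * b"
    proof -
      have "2 * u * 1 \<le> 2 * (1 + u) * pi" using u pi_gt3 by (intro mult_mono) auto
      then have "sqrt (2 * u) \<le> sqrt (2 * pi * (1 + u))" by (intro real_sqrt_le_mono) (simp add: mult_ac)
      then have "normal_density 0 (sqrt (1 + u)) x \<le> 1 / sqrt (2 * u)"
        using u unfolding normal_density_def by (simp add: frac_le)
      moreover have "x\<^sup>2 \<le> (sqrt 2 * b)\<^sup>2" using x b by (subst abs_le_square_iff[symmetric]) simp
      then have "x\<^sup>2 \<le> 2 * b\<^sup>2" by (simp add: power_mult_distrib)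
      then have "k\<^sup>2 * x\<^sup>2 \<le> 1 * (2 * b\<^sup>2)" using k by (intro mult_mono power_le_one) auto
      then have "scale_risk 0 x u \<le> 3 * b\<^sup>2"
        unfolding sr using k one_le_power[OF b, of 2] by linarith
      ultimately have "normal_density 0 (sqrt (1 + u)) x * scale_risk 0 x u \<le> 1 / sqrt (2 * u) * (3 * b\<^sup>2)"
        using k u by (intro mult_mono) (auto simp: sr)
      then show ?thesis by simp
    qed
    then show "ennreal (normal_density 0 (sqrt (1 + u)) x * scale_risk 0 x u) * indicator {x. \<bar>x\<bar> \<le> sqrt 2 * b} x \<le>
        ennreal (3 * b\<^sup>2 / sqrt (2 * u)) * indicator {- (sqrt 2 * b)..sqrt 2 * b} x"
      by (auto simp: indicator_def abs_le_iff intro!: ennreal_leI)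
  qed
  also have "\<dots> = ennreal (3 * b\<^sup>2 / sqrt (2 * u) * (2 * (sqrt 2 * b)))"
    using b u by (subst nn_integral_cmult_indicator) (simp_all add: ennreal_mult[symmetric])
  also have "3 * b\<^sup>2 / sqrt (2 * u) * (2 * (sqrt 2 * b)) = 6 * (b ^ 3 / sqrt u)"
    using u by (simp add: real_sqrt_mult field_simps power2_eq_square power3_eq_cube)
  finally have 2: "?I \<le> ennreal (6 * (b ^ 3 / sqrt u))" .
  show ?thesis using 1 2 by (cases "u \<le> b ^ 3 / sqrt u") (simp_all add: min_def)
qed

lemma nn_integral_add_cmult_add:
  assumes "f \<in> borel_measurable M" "g \<in> borel_measurable M" "h \<in> borel_measurable M"
  shows "(\<integral>\<^sup>+x. f x + c * g x + h x \<partial>M) = integral\<^sup>N M f + c * integral\<^sup>N M g + integral\<^sup>N M h"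
  using assms by (simp add: nn_integral_add nn_integral_cmult)

lemma mult_exp_minus_le_1: "y * exp (- y) \<le> (1 :: real)"
proof -
  have "y \<le> exp y" using exp_ge_add_one_self[of y] by linarith
  then show ?thesis by (simp add: exp_minus divide_simps)
qed

text \<open>
  Three contributions: scales below \<open>s\<close>; larger scales at moderate \<open>x\<close>, which are integrated over
  \<open>x\<close> before \<open>u\<close>; and large \<open>x\<close>, where only the smallness of the normal tail is used.
\<close>

lemma noise_risk_le:
  assumes \<pi>: "mixing_density \<pi>" and b: "1 \<le> b" and c: "0 < c" and C: "0 \<le> C"
    and s: "s = b\<^sup>2 * exp (- b\<^sup>2)"
    and mass: "ennreal c \<le> (\<integral>\<^sup>+u. ennreal (\<pi> u) * indicator {0..1} u \<partial>lborel)"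
    and tail: "(\<integral>\<^sup>+u. ennreal (min u (b ^ 3 / sqrt u) * \<pi> u) * indicator {s..} u \<partial>lborel) \<le> ennreal (C * s)"
  shows "(\<integral>\<^sup>+x. coord_risk \<pi> 0 x \<partial>normal_law 0 1) \<le> ennreal ((14 + 12 * C / c) * s)"
proof -
  note [measurable] = mixing_densityD(1)[OF \<pi>]
  \<comment> \<open>At \<open>sqrt 2 * b\<close> the standard normal density has decayed to the order of \<open>exp (- b\<^sup>2)\<close>.\<close>
  define B where "B = sqrt 2 * b"
  \<comment> \<open>The part of the numerator of \<open>coord_risk \<pi> 0 x\<close> due to the scales above \<open>s\<close>.\<close>
  define G where "G x = (\<integral>\<^sup>+u. ennreal (weight \<pi> x u) * ennreal (scale_risk 0 x u) * indicator {s..} u \<partial>lborel)" for x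
  have [measurable]: "G \<in> borel_measurable borel" unfolding G_def by measurable
  have s0: "0 < s" using b by (simp add: s)
  have s1: "s \<le> 1" unfolding s by (rule mult_exp_minus_le_1)
  have B: "sqrt 2 \<le> B" using b by (simp add: B_def)
  let ?\<phi> = "std_normal_density"
  have sr: "scale_risk 0 x u = u / (1 + u) + (u / (1 + u))\<^sup>2 * x\<^sup>2" for x u
    by (simp add: scale_risk_def power_mult_distrib power_divide)
  have sr_nonneg: "0 \<le> scale_risk 0 x u" if "0 \<le> u" for x u
    using that by (simp add: scale_risk_def)
  have small: "coord_risk \<pi> 0 x \<le> ennreal (s + s\<^sup>2 * x\<^sup>2) + G x / evidence \<pi> x" for x
  proof -
    have "(\<integral>\<^sup>+u. ennreal (weight \<pi> x u) * ennreal (scale_risk 0 x u) \<partial>lborel) \<le>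
        (\<integral>\<^sup>+u. ennreal (s + s\<^sup>2 * x\<^sup>2) * ennreal (weight \<pi> x u) +
          ennreal (weight \<pi> x u) * ennreal (scale_risk 0 x u) * indicator {s..} u \<partial>lborel)"
    proof (rule nn_integral_mono)
      fix u
      have "scale_risk 0 x u \<le> s + s\<^sup>2 * x\<^sup>2" if u: "0 \<le> u" "u < s"
      proof -
        have "u / (1 + u) \<le> u / 1" using u by (intro divide_left_mono) auto
        then have "u / (1 + u) \<le> s" using u by simp
        then show ?thesis unfolding sr using u by (intro add_mono mult_right_mono power_mono) auto
      qed
      then show "ennreal (weight \<pi> x u) * ennreal (scale_risk 0 x u) \<le>
          ennreal (s + s\<^sup>2 * x\<^sup>2) * ennreal (weight \<pi> x u) +
          ennreal (weight \<pi> x u) * ennreal (scale_risk 0 x u) * indicator {s..} u"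
        by (cases "u < 0"; cases "u < s")
          (auto simp: weight_def mixing_densityD(3)[OF \<pi>] mult.commute[of "ennreal (_ * _)"]
            intro!: mult_right_mono ennreal_leI simp del: ennreal_plus)
    qed
    also have "\<dots> = ennreal (s + s\<^sup>2 * x\<^sup>2) * evidence \<pi> x + G x"
      unfolding evidence_def G_def by (subst nn_integral_add) (simp_all add: nn_integral_cmult)
    finally have "coord_risk \<pi> 0 x \<le> (ennreal (s + s\<^sup>2 * x\<^sup>2) * evidence \<pi> x + G x) / evidence \<pi> x"
      unfolding coord_risk_def by (rule divide_right_mono_ennreal)
    also have "\<dots> \<le> ennreal (s + s\<^sup>2 * x\<^sup>2) + G x / evidence \<pi> x"
      unfolding add_divide_distrib_ennreal by (intro add_right_mono ennreal_divide_le_of_le_mult) simp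
    finally show ?thesis .
  qed
  have large: "coord_risk \<pi> 0 x \<le> ennreal (1 + x\<^sup>2)" for x
    unfolding coord_risk_def
  proof (rule ennreal_divide_le_of_le_mult)
    have "ennreal (weight \<pi> x u) * ennreal (scale_risk 0 x u) \<le> ennreal (1 + x\<^sup>2) * ennreal (weight \<pi> x u)" for u
    proof (cases "u < 0")
      case False
      then have "u / (1 + u) \<le> 1" by simp
      moreover have "(u / (1 + u))\<^sup>2 * x\<^sup>2 \<le> 1 * x\<^sup>2"
        using False by (intro mult_right_mono power_le_one) auto
      ultimately have "scale_risk 0 x u \<le> 1 + x\<^sup>2" unfolding sr by linarith
      then show ?thesis by (subst mult.commute) (intro mult_right_mono ennreal_leI, simp_all)
    qed (simp add: weight_def mixing_densityD(3)[OF \<pi>])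
    then show "(\<integral>\<^sup>+u. ennreal (weight \<pi> x u) * ennreal (scale_risk 0 x u) \<partial>lborel) \<le> ennreal (1 + x\<^sup>2) * evidence \<pi> x"
      unfolding evidence_def by (subst nn_integral_cmult[symmetric]) (auto intro!: nn_integral_mono)
  qed
  have point: "ennreal (?\<phi> x) * coord_risk \<pi> 0 x \<le>
      (ennreal s * ennreal (?\<phi> x) + ennreal (s\<^sup>2) * ennreal (?\<phi> x * (x - 0)\<^sup>2)) +
      ennreal (sqrt 2 / c) * (G x * indicator {x. \<bar>x\<bar> \<le> B} x) +
      ennreal (?\<phi> x * (1 + x\<^sup>2)) * indicator {x. B < \<bar>x\<bar>} x" for x
  proof (cases "\<bar>x\<bar> \<le> B")
    case True
    have \<phi>: "0 < ?\<phi> x" by (simp add: normal_density_pos)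
    define d where "d = ?\<phi> x / sqrt 2 * c"
    have d: "0 < d" using \<phi> c by (simp add: d_def)
    have "G x = ennreal (1 / d) * G x * ennreal d"
      using d by (simp add: mult.assoc mult.commute[of "G x"]) (simp add: mult.assoc[symmetric] ennreal_mult[symmetric])
    also have "\<dots> \<le> ennreal (1 / d) * G x * evidence \<pi> x"
      unfolding d_def by (intro mult_left_mono evidence_ge[OF \<pi> _ mass]) (use c in auto)
    finally have "ennreal (?\<phi> x) * (G x / evidence \<pi> x) \<le> ennreal (?\<phi> x) * (ennreal (1 / d) * G x)"
      by (intro mult_left_mono ennreal_divide_le_of_le_mult) simp_all
    also have "\<dots> = ennreal (?\<phi> x * (1 / d)) * G x"
      using d by (simp only: ennreal_mult[OF normal_density_nonneg] zero_le_divide_1_iff less_imp_le mult.assoc)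
    also have "?\<phi> x * (1 / d) = sqrt 2 / c" using \<phi> c by (simp add: d_def)
    finally have "ennreal (?\<phi> x) * ennreal (s + s\<^sup>2 * x\<^sup>2) + ennreal (?\<phi> x) * (G x / evidence \<pi> x) \<le>
        ennreal (?\<phi> x) * ennreal (s + s\<^sup>2 * x\<^sup>2) + ennreal (sqrt 2 / c) * G x"
      by (rule add_left_mono)
    moreover have "ennreal (?\<phi> x) * coord_risk \<pi> 0 x \<le>
        ennreal (?\<phi> x) * (ennreal (s + s\<^sup>2 * x\<^sup>2) + G x / evidence \<pi> x)"
      by (intro mult_left_mono small) simp
    ultimately have "ennreal (?\<phi> x) * coord_risk \<pi> 0 x \<le>
        ennreal (?\<phi> x) * ennreal (s + s\<^sup>2 * x\<^sup>2) + ennreal (sqrt 2 / c) * G x"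
      unfolding distrib_left by (rule order_trans[rotated])
    also have "ennreal (?\<phi> x) * ennreal (s + s\<^sup>2 * x\<^sup>2) =
        ennreal s * ennreal (?\<phi> x) + ennreal (s\<^sup>2) * ennreal (?\<phi> x * (x - 0)\<^sup>2)"
      using s0 by (simp add: ennreal_mult[symmetric] ennreal_plus[symmetric] distrib_left mult_ac del: ennreal_plus)
    finally show ?thesis using True by simp
  next
    case False
    have "ennreal (?\<phi> x) * coord_risk \<pi> 0 x \<le> ennreal (?\<phi> x) * ennreal (1 + x\<^sup>2)"
      by (intro mult_left_mono large) simp
    also have "\<dots> = ennreal (?\<phi> x * (1 + x\<^sup>2))" by (simp add: ennreal_mult')
    finally show ?thesis using False by (simp add: add_increasing)
  qed
  \<comment> \<open>The normalising constant is gone, so the order of integration can be exchanged.\<close>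
  have "(\<integral>\<^sup>+x. G x * indicator {x. \<bar>x\<bar> \<le> B} x \<partial>lborel) =
      (\<integral>\<^sup>+x. \<integral>\<^sup>+u. ennreal (weight \<pi> x u) * ennreal (scale_risk 0 x u) * indicator {s..} u *
        indicator {x. \<bar>x\<bar> \<le> B} x \<partial>lborel \<partial>lborel)"
    unfolding G_def by (intro nn_integral_cong nn_integral_multc[symmetric]) measurable
  also have "\<dots> = (\<integral>\<^sup>+u. \<integral>\<^sup>+x. ennreal (weight \<pi> x u) * ennreal (scale_risk 0 x u) * indicator {s..} u *
        indicator {x. \<bar>x\<bar> \<le> B} x \<partial>lborel \<partial>lborel)"
    by (rule lborel_pair.Fubini') measurable
  also have "\<dots> \<le> (\<integral>\<^sup>+u. 6 * (ennreal (min u (b ^ 3 / sqrt u) * \<pi> u) * indicator {s..} u) \<partial>lborel)"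
  proof (rule nn_integral_mono)
    fix u
    show "(\<integral>\<^sup>+x. ennreal (weight \<pi> x u) * ennreal (scale_risk 0 x u) * indicator {s..} u *
        indicator {x. \<bar>x\<bar> \<le> B} x \<partial>lborel) \<le> 6 * (ennreal (min u (b ^ 3 / sqrt u) * \<pi> u) * indicator {s..} u)"
    proof (cases "s \<le> u")
      case True
      then have u: "0 < u" using s0 by simp
      note nn = mixing_densityD(2)[OF \<pi>, of u]
      have "(\<integral>\<^sup>+x. ennreal (weight \<pi> x u) * ennreal (scale_risk 0 x u) * indicator {s..} u *
        indicator {x. \<bar>x\<bar> \<le> B} x \<partial>lborel) =
        (\<integral>\<^sup>+x. ennreal (\<pi> u) * (ennreal (normal_density 0 (sqrt (1 + u)) x * scale_risk 0 x u) *
          indicator {x. \<bar>x\<bar> \<le> B} x) \<partial>lborel)"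
        using True nn sr_nonneg[OF less_imp_le[OF u]] by (simp add: weight_def ennreal_mult mult.assoc)
      also have "\<dots> = ennreal (\<pi> u) * (\<integral>\<^sup>+x. ennreal (normal_density 0 (sqrt (1 + u)) x * scale_risk 0 x u) *
          indicator {x. \<bar>x\<bar> \<le> B} x \<partial>lborel)"
        by (rule nn_integral_cmult) measurable
      also have "\<dots> \<le> ennreal (\<pi> u) * ennreal (6 * min u (b ^ 3 / sqrt u))"
        unfolding B_def by (intro mult_left_mono scale_risk_truncated_le u b) simp
      also have "\<dots> = 6 * (ennreal (min u (b ^ 3 / sqrt u) * \<pi> u) * indicator {s..} u)"
        using True nn u b by (simp add: ennreal_mult mult_ac)
      finally show ?thesis .
    qed simp
  qed
  also have "\<dots> \<le> 6 * ennreal (C * s)"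
    by (subst nn_integral_cmult) (measurable, intro mult_left_mono tail, simp)
  finally have mid: "(\<integral>\<^sup>+x. G x * indicator {x. \<bar>x\<bar> \<le> B} x \<partial>lborel) \<le> 6 * ennreal (C * s)" .
  have "6 * B * ?\<phi> B \<le> 12 * s"
  proof -
    have "?\<phi> B \<le> exp (- b\<^sup>2)"
      using pi_gt3 by (simp add: std_normal_density_def B_def power_mult_distrib divide_simps real_le_rsqrt)
    moreover have "B \<le> 2 * b\<^sup>2"
    proof -
      have "sqrt 2 \<le> 2" by (rule real_le_lsqrt) auto
      then have "B \<le> 2 * b" using b by (simp add: B_def)
      also have "\<dots> \<le> 2 * b\<^sup>2" using b by (simp add: power2_eq_square)
      finally show ?thesis .
    qed
    ultimately have "B * ?\<phi> B \<le> 2 * b\<^sup>2 * exp (- b\<^sup>2)"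
      by (intro mult_mono) auto
    then show ?thesis by (simp add: s)
  qed
  then have far: "(\<integral>\<^sup>+x. ennreal (?\<phi> x * (1 + x\<^sup>2)) * indicator {x. B < \<bar>x\<bar>} x \<partial>lborel) \<le> ennreal (12 * s)"
    by (rule order_trans[OF std_normal_tail[OF B] ennreal_leI])
  have near: "(\<integral>\<^sup>+x. ennreal s * ennreal (?\<phi> x) + ennreal (s\<^sup>2) * ennreal (?\<phi> x * (x - 0)\<^sup>2) \<partial>lborel) = ennreal (s + s\<^sup>2)"
    using s0 nn_integral_normal_square[of 1 0 0]
    by (subst nn_integral_add) (simp_all add: nn_integral_cmult nn_integral_normal_density)
  have "(\<integral>\<^sup>+x. coord_risk \<pi> 0 x \<partial>normal_law 0 1) = (\<integral>\<^sup>+x. ennreal (?\<phi> x) * coord_risk \<pi> 0 x \<partial>lborel)"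
    by (simp add: normal_law_def nn_integral_density)
  also have "\<dots> \<le> (\<integral>\<^sup>+x. (ennreal s * ennreal (?\<phi> x) + ennreal (s\<^sup>2) * ennreal (?\<phi> x * (x - 0)\<^sup>2)) +
      ennreal (sqrt 2 / c) * (G x * indicator {x. \<bar>x\<bar> \<le> B} x) +
      ennreal (?\<phi> x * (1 + x\<^sup>2)) * indicator {x. B < \<bar>x\<bar>} x \<partial>lborel)"
    by (intro nn_integral_mono point)
  also have "\<dots> = (\<integral>\<^sup>+x. ennreal s * ennreal (?\<phi> x) + ennreal (s\<^sup>2) * ennreal (?\<phi> x * (x - 0)\<^sup>2) \<partial>lborel) +
      ennreal (sqrt 2 / c) * (\<integral>\<^sup>+x. G x * indicator {x. \<bar>x\<bar> \<le> B} x \<partial>lborel) +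
      (\<integral>\<^sup>+x. ennreal (?\<phi> x * (1 + x\<^sup>2)) * indicator {x. B < \<bar>x\<bar>} x \<partial>lborel)"
    by (rule nn_integral_add_cmult_add) measurable
  also have "\<dots> \<le> ennreal (s + s\<^sup>2) + ennreal (sqrt 2 / c) * (6 * ennreal (C * s)) + ennreal (12 * s)"
    unfolding near by (intro add_mono mult_left_mono mid far order_refl) simp
  also have "\<dots> = ennreal (s + s\<^sup>2 + sqrt 2 / c * (6 * (C * s)) + 12 * s)"
  proof -
    have "ennreal (sqrt 2 / c) * (6 * ennreal (C * s)) = ennreal (sqrt 2 / c * (6 * (C * s)))"
      using s0 c C ennreal_mult[of "sqrt 2 / c" "6 * (C * s)"] ennreal_mult[of 6 "C * s"] by simp
    moreover have "0 \<le> sqrt 2 / c * (6 * (C * s))" "0 \<le> s + s\<^sup>2" "0 \<le> 12 * s"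
      using s0 c C by simp_all
    ultimately show ?thesis by (metis add_nonneg_nonneg ennreal_plus)
  qed
  also have "\<dots> \<le> ennreal ((14 + 12 * C / c) * s)"
  proof (rule ennreal_leI)
    have "s\<^sup>2 \<le> s" using s0 s1 by (simp add: power2_eq_square mult_left_le)
    moreover have "sqrt 2 * (6 * (C * s) / c) \<le> 2 * (6 * (C * s) / c)"
      using s0 c C by (intro mult_right_mono real_le_lsqrt) auto
    ultimately show "s + s\<^sup>2 + sqrt 2 / c * (6 * (C * s)) + 12 * s \<le> (14 + 12 * C / c) * s"
      by (simp add: algebra_simps)
  qed
  finally show ?thesis .
qed

section \<open>Truncated tails of the mixing density\<close>

lemma set_nn_integral_eq_LBINT:
  fixes f :: "real \<Rightarrow> real"
  assumes "set_integrable lborel A f" and "\<And>u. u \<in> A \<Longrightarrow> 0 \<le> f u"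
  shows "(\<integral>\<^sup>+u. ennreal (f u) * indicator A u \<partial>lborel) = ennreal (LBINT u:A. f u)"
proof -
  have "(\<integral>\<^sup>+u. ennreal (f u) * indicator A u \<partial>lborel) = (\<integral>\<^sup>+u. ennreal (indicator A u *\<^sub>R f u) \<partial>lborel)"
    by (intro nn_integral_cong) (auto simp: indicator_def)
  also have "\<dots> = ennreal (LBINT u:A. f u)"
    unfolding set_lebesgue_integral_def
    using assms by (intro nn_integral_eq_integral) (auto simp: set_integrable_def indicator_def)
  finally show ?thesis .
qed

lemma set_integrable_mixing_density:
  assumes "mixing_density \<pi>" "A \<in> sets borel"
  shows "set_integrable lborel A \<pi>"
  using mixing_densityD(5)[OF assms(1)] assms(2) unfolding set_integrable_def
  by (intro integrable_mult_indicator) auto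

text \<open>Under a bound on the tail of \<open>\<pi>\<close>, the mass that is not far out must lie in \<open>[0, 1]\<close>.\<close>

lemma mass_ge_half:
  assumes \<pi>: "mixing_density \<pi>"
    and "(\<integral>\<^sup>+u. ennreal (\<pi> u) * indicator {1..} u \<partial>lborel) \<le> ennreal (1 / 2)"
  shows "ennreal (1 / 2) \<le> (\<integral>\<^sup>+u. ennreal (\<pi> u) * indicator {0..1} u \<partial>lborel)" (is "_ \<le> ?m")
proof -
  note [measurable] = mixing_densityD(1)[OF \<pi>]
  have "1 = (\<integral>\<^sup>+u. ennreal (\<pi> u) \<partial>lborel)" using mixing_densityD(4)[OF \<pi>] by simp
  also have "\<dots> \<le> (\<integral>\<^sup>+u. ennreal (\<pi> u) * indicator {0..1} u + ennreal (\<pi> u) * indicator {1..} u \<partial>lborel)"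
  proof (rule nn_integral_mono)
    fix u
    show "ennreal (\<pi> u) \<le> ennreal (\<pi> u) * indicator {0..1} u + ennreal (\<pi> u) * indicator {1..} u"
      using mixing_densityD(3)[OF \<pi>, of u] by (cases "u < 0"; cases "u \<le> 1") (auto simp: indicator_def)
  qed
  also have "\<dots> = ?m + (\<integral>\<^sup>+u. ennreal (\<pi> u) * indicator {1..} u \<partial>lborel)"
    by (rule nn_integral_add) measurable
  also have "\<dots> \<le> ?m + ennreal (1 / 2)" by (intro add_left_mono assms)
  finally have "1 \<le> ?m + ennreal (1 / 2)" .
  show ?thesis
  proof (cases ?m)
    case (real r)
    have "ennreal 1 \<le> ennreal (r + 1 / 2)"
      using \<open>1 \<le> ?m + ennreal (1 / 2)\<close> real ennreal_plus[of r "1 / 2"] by simp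
    then have "1 \<le> r + 1 / 2" using real by (subst (asm) ennreal_le_iff) auto
    then have "ennreal (1 / 2) \<le> ennreal r" by (intro ennreal_leI) simp
    then show ?thesis unfolding real(2) .
  qed simp
qed

text \<open>The two bounds cross at \<open>u = b\<^sup>2\<close>.\<close>

lemma truncated_scale_le:
  assumes "0 < u" "0 < b"
  shows "min u (b ^ 3 / sqrt u) \<le> b\<^sup>2" and "0 \<le> min u (b ^ 3 / sqrt u)"
proof -
  show "min u (b ^ 3 / sqrt u) \<le> b\<^sup>2"
  proof (cases "u \<le> b\<^sup>2")
    case False
    then have "b \<le> sqrt u" using assms by (intro real_le_rsqrt) simp
    then have "b ^ 3 / sqrt u \<le> b ^ 3 / b" using assms by (intro divide_left_mono) auto
    also have "\<dots> = b\<^sup>2" using assms by (simp add: power2_eq_square power3_eq_cube)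
    finally show ?thesis by simp
  qed simp
qed (use assms in auto)

text \<open>
  The truncated scale is at most \<open>b\<^sup>2\<close>, so its product with \<open>\<pi>\<close> is integrable, and the real-valued
  integral in the hypothesis agrees with the one in \<open>[0, \<infinity>]\<close>.
\<close>

lemma tail_of_C3:
  assumes \<pi>: "mixing_density \<pi>" and b: "0 < b" and s: "0 < s"
    and C3: "(LBINT u:{s..}. min u (b ^ 3 / sqrt u) * \<pi> u) + b * (LBINT u:{1..b\<^sup>2}. \<pi> u / sqrt u) \<le> C * s"
  shows "(\<integral>\<^sup>+u. ennreal (min u (b ^ 3 / sqrt u) * \<pi> u) * indicator {s..} u \<partial>lborel) \<le> ennreal (C * s)"
proof -
  note [measurable] = mixing_densityD(1)[OF \<pi>] and nn = mixing_densityD(2)[OF \<pi>]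
  have "set_integrable lborel {s..} (\<lambda>u. min u (b ^ 3 / sqrt u) * \<pi> u)"
    unfolding set_integrable_def
  proof (rule Bochner_Integration.integrable_bound)
    show "integrable lborel (\<lambda>u. b\<^sup>2 * \<pi> u)" using mixing_densityD(5)[OF \<pi>] by simp
    show "AE u in lborel. norm (indicator {s..} u *\<^sub>R (min u (b ^ 3 / sqrt u) * \<pi> u)) \<le> norm (b\<^sup>2 * \<pi> u)"
    proof (rule AE_I2)
      fix u
      show "norm (indicator {s..} u *\<^sub>R (min u (b ^ 3 / sqrt u) * \<pi> u)) \<le> norm (b\<^sup>2 * \<pi> u)"
        using truncated_scale_le[of u b] b s nn[of u]
        by (cases "s \<le> u") (auto simp: abs_mult intro!: mult_right_mono)
    qed
  qed measurable
  then have "(\<integral>\<^sup>+u. ennreal (min u (b ^ 3 / sqrt u) * \<pi> u) * indicator {s..} u \<partial>lborel) =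
      ennreal (LBINT u:{s..}. min u (b ^ 3 / sqrt u) * \<pi> u)"
    using truncated_scale_le(2) b s nn by (intro set_nn_integral_eq_LBINT mult_nonneg_nonneg) auto
  also have "\<dots> \<le> ennreal (C * s)"
  proof (rule ennreal_leI)
    have "0 \<le> (LBINT u:{1..b\<^sup>2}. \<pi> u / sqrt u)"
      unfolding set_lebesgue_integral_def
      by (intro integral_nonneg_AE AE_I2) (auto simp: indicator_def nn)
    with b have "0 \<le> b * (LBINT u:{1..b\<^sup>2}. \<pi> u / sqrt u)" by simp
    with C3 show "(LBINT u:{s..}. min u (b ^ 3 / sqrt u) * \<pi> u) \<le> C * s" by linarith
  qed
  finally show ?thesis .
qed

lemma tail_of_CB:
  assumes \<pi>: "mixing_density \<pi>" and b: "0 < b" and s: "0 < s"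
    and CB: "(\<integral>\<^sup>+u. ennreal (\<pi> u) * indicator {s..} u \<partial>lborel) \<le> ennreal q"
  shows "(\<integral>\<^sup>+u. ennreal (min u (b ^ 3 / sqrt u) * \<pi> u) * indicator {s..} u \<partial>lborel) \<le> ennreal (b\<^sup>2 * q)"
proof -
  note [measurable] = mixing_densityD(1)[OF \<pi>] and nn = mixing_densityD(2)[OF \<pi>]
  have "(\<integral>\<^sup>+u. ennreal (min u (b ^ 3 / sqrt u) * \<pi> u) * indicator {s..} u \<partial>lborel) \<le>
      (\<integral>\<^sup>+u. ennreal (b\<^sup>2) * (ennreal (\<pi> u) * indicator {s..} u) \<partial>lborel)"
  proof (rule nn_integral_mono)
    fix u
    show "ennreal (min u (b ^ 3 / sqrt u) * \<pi> u) * indicator {s..} u \<le>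
        ennreal (b\<^sup>2) * (ennreal (\<pi> u) * indicator {s..} u)"
      using truncated_scale_le[of u b] b s nn[of u]
      by (cases "s \<le> u") (auto simp: ennreal_mult[symmetric] intro!: mult_right_mono ennreal_leI)
  qed
  also have "\<dots> = ennreal (b\<^sup>2) * (\<integral>\<^sup>+u. ennreal (\<pi> u) * indicator {s..} u \<partial>lborel)"
    by (rule nn_integral_cmult) measurable
  also have "\<dots> \<le> ennreal (b\<^sup>2) * ennreal q" by (intro mult_left_mono CB) simp
  finally show ?thesis by (simp add: ennreal_mult')
qed

lemma powr_three_halves:
  assumes "0 < (u :: real)"
  shows "u powr (3 / 2) = u * sqrt u"
proof -
  have "u powr (3 / 2) = u powr (1 + 1 / 2)" by simp
  also have "\<dots> = u powr 1 * u powr (1 / 2)" by (rule powr_add)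
  also have "\<dots> = u * sqrt u" using assms by (simp add: powr_half_sqrt)
  finally show ?thesis .
qed

text \<open>
  With \<open>\<pi> u\<close> below a multiple of \<open>u powr (- 3 / 2)\<close>, the truncated tail is an explicit integral,
  of \<open>1 / sqrt u\<close> up to \<open>b\<^sup>2\<close> and of \<open>b\<^sup>3 / u\<^sup>2\<close> beyond; both parts are of order \<open>b\<close>.
\<close>

lemma tail_of_CA:
  assumes \<pi>: "mixing_density \<pi>" and b: "1 \<le> b" and s: "0 < s" "s \<le> 1" and q: "0 \<le> q"
    and CA: "\<forall>u\<ge>s. \<pi> u \<le> q / (u * sqrt u)"
  shows "(\<integral>\<^sup>+u. ennreal (min u (b ^ 3 / sqrt u) * \<pi> u) * indicator {s..} u \<partial>lborel) \<le> ennreal (3 * b * q)"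
    and "(\<integral>\<^sup>+u. ennreal (\<pi> u) * indicator {1..} u \<partial>lborel) \<le> ennreal (2 * q)"
proof -
  note [measurable] = mixing_densityD(1)[OF \<pi>] and nn = mixing_densityD(2)[OF \<pi>]
  have b1: "1 \<le> b\<^sup>2" using b by (rule one_le_power)
  have near: "(\<integral>\<^sup>+u. ennreal (1 / sqrt u) * indicator {s..b\<^sup>2} u \<partial>lborel) = ennreal (2 * sqrt (b\<^sup>2) - 2 * sqrt s)"
  proof (rule nn_integral_FTC_Icc[where F="\<lambda>u. 2 * sqrt u"])
    fix u assume "u \<in> {s..b\<^sup>2}"
    with s have "0 < u" by simp
    then show "((\<lambda>u. 2 * sqrt u) has_real_derivative 1 / sqrt u) (at u)"
      by (auto intro!: derivative_eq_intros simp: field_simps)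
  qed (use s b1 in auto)
  have zero: "((\<lambda>u :: real. c / sqrt u) \<longlongrightarrow> 0) at_top" "((\<lambda>u :: real. c / u) \<longlongrightarrow> 0) at_top" for c
    by (rule tendsto_divide_0[OF tendsto_const filterlim_at_top_imp_at_infinity],
        rule sqrt_at_top filterlim_ident)+
  have far: "(\<integral>\<^sup>+u. ennreal (b ^ 3 / u\<^sup>2) * indicator {b\<^sup>2..} u \<partial>lborel) = ennreal (0 - (- (b ^ 3)) / b\<^sup>2)"
  proof (rule nn_integral_FTC_atLeast[where F="\<lambda>u. - (b ^ 3) / u"])
    fix u assume "b\<^sup>2 \<le> u"
    with b1 have "0 < u" by simp
    then show "((\<lambda>u. - (b ^ 3) / u) has_real_derivative b ^ 3 / u\<^sup>2) (at u)"
      by (auto intro!: derivative_eq_intros simp: power2_eq_square)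
  qed (use b zero(2)[of "- (b ^ 3)"] in auto)
  have one: "(\<integral>\<^sup>+u. ennreal (1 / (u * sqrt u)) * indicator {1..} u \<partial>lborel) = ennreal (0 - (- 2) / sqrt 1)"
  proof (rule nn_integral_FTC_atLeast[where F="\<lambda>u. - 2 / sqrt u"])
    fix u :: real assume "1 \<le> u"
    then show "((\<lambda>u. - 2 / sqrt u) has_real_derivative 1 / (u * sqrt u)) (at u)"
      by (auto intro!: derivative_eq_intros simp: field_simps)
  qed (use zero(1)[of "- 2"] in auto)
  have "(\<integral>\<^sup>+u. ennreal (\<pi> u) * indicator {1..} u \<partial>lborel) \<le>
      (\<integral>\<^sup>+u. ennreal q * (ennreal (1 / (u * sqrt u)) * indicator {1..} u) \<partial>lborel)"
  proof (rule nn_integral_mono)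
    fix u
    show "ennreal (\<pi> u) * indicator {1..} u \<le> ennreal q * (ennreal (1 / (u * sqrt u)) * indicator {1..} u)"
      using CA s q by (auto simp: indicator_def ennreal_mult[symmetric] intro!: ennreal_leI)
  qed
  also have "\<dots> = ennreal q * ennreal 2"
    using one by (subst nn_integral_cmult) simp_all
  finally show "(\<integral>\<^sup>+u. ennreal (\<pi> u) * indicator {1..} u \<partial>lborel) \<le> ennreal (2 * q)"
    using q by (simp add: ennreal_mult mult.commute)
  have "(\<integral>\<^sup>+u. ennreal (min u (b ^ 3 / sqrt u) * \<pi> u) * indicator {s..} u \<partial>lborel) \<le>
      (\<integral>\<^sup>+u. ennreal q * (ennreal (1 / sqrt u) * indicator {s..b\<^sup>2} u + ennreal (b ^ 3 / u\<^sup>2) * indicator {b\<^sup>2..} u) \<partial>lborel)"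
  proof (rule nn_integral_mono)
    fix u
    have "min u (b ^ 3 / sqrt u) * \<pi> u \<le> q * (1 / sqrt u)" if u: "s \<le> u"
    proof -
      have "0 < u" using u s by simp
      have "min u (b ^ 3 / sqrt u) * \<pi> u \<le> u * (q / (u * sqrt u))"
        using CA[rule_format, OF u] \<open>0 < u\<close> nn by (intro mult_mono) auto
      then show ?thesis using \<open>0 < u\<close> by simp
    qed
    moreover have "min u (b ^ 3 / sqrt u) * \<pi> u \<le> q * (b ^ 3 / u\<^sup>2)" if u: "s \<le> u"
    proof -
      have "0 < u" using u s by simp
      have "min u (b ^ 3 / sqrt u) * \<pi> u \<le> (b ^ 3 / sqrt u) * (q / (u * sqrt u))"
        using CA[rule_format, OF u] \<open>0 < u\<close> nn b by (intro mult_mono) auto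
      then show ?thesis using \<open>0 < u\<close> by (simp add: power2_eq_square mult_ac)
    qed
    ultimately show "ennreal (min u (b ^ 3 / sqrt u) * \<pi> u) * indicator {s..} u \<le>
        ennreal q * (ennreal (1 / sqrt u) * indicator {s..b\<^sup>2} u + ennreal (b ^ 3 / u\<^sup>2) * indicator {b\<^sup>2..} u)"
      using q b1 s by (cases "s \<le> u"; cases "u \<le> b\<^sup>2")
        (auto simp: ennreal_mult'[symmetric] distrib_left intro!: add_increasing2 ennreal_leI)
  qed
  also have "\<dots> = ennreal q * (ennreal (2 * b - 2 * sqrt s) + ennreal b)"
    using near far b by (subst nn_integral_cmult, measurable)
      (simp add: nn_integral_add power2_eq_square power3_eq_cube)
  also have "\<dots> \<le> ennreal q * (ennreal (2 * b) + ennreal b)"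
    using s by (intro mult_left_mono add_right_mono ennreal_leI) auto
  also have "\<dots> = ennreal (3 * b * q)"
    using b q by (simp add: ennreal_plus[symmetric] ennreal_mult[symmetric] mult_ac del: ennreal_plus)
  finally show "(\<integral>\<^sup>+u. ennreal (min u (b ^ 3 / sqrt u) * \<pi> u) * indicator {s..} u \<partial>lborel) \<le> ennreal (3 * b * q)" .
qed

section \<open>Contraction at the rate p log (n / p)\<close>

text \<open>These identities replace \<open>n\<close> and \<open>p n\<close> by the single parameter \<open>b_seq p n\<close>.\<close>

lemma sequence_identities:
  assumes "0 < p n" "p n < real n"
  shows "0 < b_seq p n" and "(b_seq p n)\<^sup>2 = ln (n / p n)" and "p n / n = exp (- (b_seq p n)\<^sup>2)"
    and "s_seq p n = (b_seq p n)\<^sup>2 * exp (- (b_seq p n)\<^sup>2)"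
proof -
  have l: "0 < ln (n / p n)" using assms by (intro ln_gt_zero) (simp add: divide_simps)
  then show "0 < b_seq p n" and sq: "(b_seq p n)\<^sup>2 = ln (n / p n)" by (simp_all add: b_seq_def)
  show q: "p n / n = exp (- (b_seq p n)\<^sup>2)"
    unfolding sq using assms by (simp add: exp_minus)
  show "s_seq p n = (b_seq p n)\<^sup>2 * exp (- (b_seq p n)\<^sup>2)"
    by (simp only: s_seq_def q sq[symmetric] mult.commute)
qed

lemma eventually_b_seq_ge:
  assumes p_ball: "\<forall>n\<ge>1. 0 < p n \<and> p n < real n" and p_small: "p \<in> o(\<lambda>n. real n)"
  shows "\<forall>\<^sub>F n in sequentially. B \<le> b_seq p n"
proof -
  note p_range = p_ball[rule_format]
  have "(\<lambda>n. p n / real n) \<longlonglongrightarrow> 0" using p_small by (rule smalloD_tendsto)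
  then have "\<forall>\<^sub>F n in sequentially. p n / real n < exp (- B\<^sup>2)"
    by (rule order_tendstoD) simp
  with eventually_ge_at_top[of 1] show ?thesis
  proof eventually_elim
    case (elim n)
    have "B\<^sup>2 < (b_seq p n)\<^sup>2" using elim sequence_identities[of p n] p_range[of n] by simp
    moreover have "0 \<le> b_seq p n"
      using sequence_identities(1)[of p n] p_range[of n] elim(1) by simp
    ultimately show ?case by (rule less_imp_le[OF power2_less_imp_less])
  qed
qed

text \<open>
  The common consequence of the three alternatives. Only the first provides mass on \<open>[0, 1]\<close>
  directly; in the other two the tail beyond \<open>1\<close> tends to \<open>0\<close>, and mass \<open>1 / 2\<close> remains for large
  \<open>n\<close>.
\<close>

lemma mixing_tail_eventually:
  fixes p :: "nat \<Rightarrow> real" and \<pi> :: "nat \<Rightarrow> real \<Rightarrow> real"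
  assumes p_ball: "\<forall>n\<ge>1. 0 < p n \<and> p n < real n"
    and p_small: "p \<in> o(\<lambda>n. real n)"
    and dens: "\<forall>n\<ge>1. mixing_density (\<pi> n)"
    and conds: "(cond_C2 \<pi> \<and> cond_C3 p \<pi>) \<or> cond_CA p \<pi> \<or> cond_CB p \<pi>"
  obtains c C where "0 < c" "0 \<le> C"
    "\<forall>\<^sub>F n in sequentially. ennreal c \<le> (\<integral>\<^sup>+u. ennreal (\<pi> n u) * indicator {0..1} u \<partial>lborel) \<and>
      (\<integral>\<^sup>+u. ennreal (min u (b_seq p n ^ 3 / sqrt u) * \<pi> n u) * indicator {s_seq p n..} u \<partial>lborel)
        \<le> ennreal (C * s_seq p n)"
proof -
  note p_range = p_ball[rule_format] and \<pi> = dens[rule_format]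
  note large = eventually_b_seq_ge[OF p_ball p_small]
  have ids: "0 < b_seq p n" "p n / n = exp (- (b_seq p n)\<^sup>2)" "s_seq p n = (b_seq p n)\<^sup>2 * exp (- (b_seq p n)\<^sup>2)"
    "0 < s_seq p n" "s_seq p n \<le> 1" if "n \<ge> 1" for n
    using sequence_identities[of p n] p_range[OF that] mult_exp_minus_le_1[of "(b_seq p n)\<^sup>2"] by simp_all
  consider "cond_C2 \<pi>" "cond_C3 p \<pi>" | "cond_CA p \<pi>" | "cond_CB p \<pi>" using conds by blast
  then show thesis
  proof cases
    case 1
    then obtain c C where c: "0 < c" "\<And>n. n \<ge> 1 \<Longrightarrow> (LBINT u:{0..1}. \<pi> n u) \<ge> c"
      and C: "\<And>n. n \<ge> 1 \<Longrightarrow> (LBINT u:{s_seq p n..}. min u (b_seq p n ^ 3 / sqrt u) * \<pi> n u) +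
        b_seq p n * (LBINT u:{1..(b_seq p n)\<^sup>2}. \<pi> n u / sqrt u) \<le> C * s_seq p n"
      unfolding cond_C2_def cond_C3_def by blast
    show thesis
    \<comment> \<open>\<open>C\<close> is not assumed to be nonnegative.\<close>
    proof (rule that[of c "max C 0"])
      show "\<forall>\<^sub>F n in sequentially. ennreal c \<le> (\<integral>\<^sup>+u. ennreal (\<pi> n u) * indicator {0..1} u \<partial>lborel) \<and>
        (\<integral>\<^sup>+u. ennreal (min u (b_seq p n ^ 3 / sqrt u) * \<pi> n u) * indicator {s_seq p n..} u \<partial>lborel)
          \<le> ennreal (max C 0 * s_seq p n)"
        using eventually_ge_at_top[of 1]
      proof eventually_elim
        case n: (elim n)
        have "ennreal c \<le> (\<integral>\<^sup>+u. ennreal (\<pi> n u) * indicator {0..1} u \<partial>lborel)"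
          using c(2)[OF n] mixing_densityD(2)[OF \<pi>[OF n]]
          by (subst set_nn_integral_eq_LBINT[OF set_integrable_mixing_density[OF \<pi>[OF n]]])
            (auto intro: ennreal_leI)
        moreover have "C * s_seq p n \<le> max C 0 * s_seq p n"
          using ids(4)[OF n] by (intro mult_right_mono) auto
        ultimately show ?case
          using tail_of_C3[OF \<pi>[OF n] ids(1)[OF n] ids(4)[OF n] C[OF n]]
          by (meson ennreal_leI order_trans)
      qed
    qed (use c in auto)
  next
    case 2
    then obtain C where C: "\<And>n u. n \<ge> 1 \<Longrightarrow> u \<ge> s_seq p n \<Longrightarrow>
        \<pi> n u \<le> C / u powr (3/2) * (p n / n) * sqrt (ln (n / p n))"
      unfolding cond_CA_def by blast
    define D where "D = max C 0"
    show thesis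
    proof (rule that[of "1 / 2" "3 * D"])
      show "\<forall>\<^sub>F n in sequentially. ennreal (1 / 2) \<le> (\<integral>\<^sup>+u. ennreal (\<pi> n u) * indicator {0..1} u \<partial>lborel) \<and>
        (\<integral>\<^sup>+u. ennreal (min u (b_seq p n ^ 3 / sqrt u) * \<pi> n u) * indicator {s_seq p n..} u \<partial>lborel)
          \<le> ennreal (3 * D * s_seq p n)"
        \<comment> \<open>\<open>4 * D \<le> b\<close> forces the tail beyond \<open>1\<close>, which is at most \<open>2 * D * b * exp (- b\<^sup>2)\<close>,
          below \<open>1 / 2\<close>, because \<open>b\<^sup>2 * exp (- b\<^sup>2) \<le> 1\<close>; likewise with \<open>2 * D\<close> in the last case.\<close>
        using eventually_ge_at_top[of 1] large[of 1] large[of "4 * D"]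
      proof eventually_elim
        case n: (elim n)
        define b where "b = b_seq p n"
        define q where "q = D * (exp (- b\<^sup>2) * b)"
        have b: "1 \<le> b" using n by (simp add: b_def)
        have q0: "0 \<le> q" using b by (simp add: q_def D_def)
        have pw: "\<forall>u\<ge>s_seq p n. \<pi> n u \<le> q / (u * sqrt u)"
        proof (intro allI impI)
          fix u assume u: "s_seq p n \<le> u"
          have u0: "0 < u" using u ids(4)[OF n(1)] by linarith
          have "\<pi> n u \<le> C / (u * sqrt u) * exp (- b\<^sup>2) * b"
            using C[OF n(1) u] ids(2)[OF n(1)] u0 by (simp add: powr_three_halves b_def b_seq_def)
          also have "\<dots> \<le> D / (u * sqrt u) * exp (- b\<^sup>2) * b"
            using u0 b by (intro mult_right_mono divide_right_mono) (auto simp: D_def)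
          finally show "\<pi> n u \<le> q / (u * sqrt u)" by (simp add: q_def mult_ac)
        qed
        have "b\<^sup>2 * exp (- b\<^sup>2) \<le> 1" by (rule mult_exp_minus_le_1)
        then have "b * (exp (- b\<^sup>2) * b) \<le> 1" by (simp add: power2_eq_square mult_ac)
        moreover have "4 * D * (exp (- b\<^sup>2) * b) \<le> b * (exp (- b\<^sup>2) * b)"
          by (rule mult_right_mono) (use n(3) b in \<open>simp_all add: b_def\<close>)
        moreover have "4 * q = 4 * D * (exp (- b\<^sup>2) * b)" by (simp add: q_def)
        ultimately have half: "2 * q \<le> 1 / 2" by linarith
        note tails = tail_of_CA[OF \<pi>[OF n(1)] b ids(4,5)[OF n(1)] q0 pw]
        have mass: "ennreal (1 / 2) \<le> (\<integral>\<^sup>+u. ennreal (\<pi> n u) * indicator {0..1} u \<partial>lborel)"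
          by (rule mass_ge_half[OF \<pi>[OF n(1)] order_trans[OF tails(2) ennreal_leI[OF half]]])
        have eq: "3 * b * q = 3 * D * s_seq p n"
          using ids(3)[OF n(1)] by (simp add: q_def b_def power2_eq_square mult_ac)
        show ?case
          using mass tails(1)[unfolded eq, unfolded b_def] by (rule conjI)
      qed
    qed (auto simp: D_def)
  next
    case 3
    then obtain C where C: "\<And>n. n \<ge> 1 \<Longrightarrow> (LBINT u:{s_seq p n..}. \<pi> n u) \<le> C * (p n / n)"
      unfolding cond_CB_def by blast
    define D where "D = max C 0"
    show thesis
    proof (rule that[of "1 / 2" D])
      show "\<forall>\<^sub>F n in sequentially. ennreal (1 / 2) \<le> (\<integral>\<^sup>+u. ennreal (\<pi> n u) * indicator {0..1} u \<partial>lborel) \<and>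
        (\<integral>\<^sup>+u. ennreal (min u (b_seq p n ^ 3 / sqrt u) * \<pi> n u) * indicator {s_seq p n..} u \<partial>lborel)
          \<le> ennreal (D * s_seq p n)"
        using eventually_ge_at_top[of 1] large[of 1] large[of "2 * D"]
      proof eventually_elim
        case n: (elim n)
        define b where "b = b_seq p n"
        define q where "q = D * exp (- b\<^sup>2)"
        have b: "1 \<le> b" using n by (simp add: b_def)
        have "(LBINT u:{s_seq p n..}. \<pi> n u) \<le> C * exp (- b\<^sup>2)"
          using C[OF n(1)] ids(2)[OF n(1)] by (simp add: b_def)
        also have "\<dots> \<le> q" unfolding q_def by (intro mult_right_mono) (auto simp: D_def)
        finally have tail: "(\<integral>\<^sup>+u. ennreal (\<pi> n u) * indicator {s_seq p n..} u \<partial>lborel) \<le> ennreal q"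
          using mixing_densityD(2)[OF \<pi>[OF n(1)]]
          by (subst set_nn_integral_eq_LBINT[OF set_integrable_mixing_density[OF \<pi>[OF n(1)]]])
            (auto intro: ennreal_leI)
        have "2 * D \<le> b * 1" using n(3) by (simp add: b_def)
        also have "\<dots> \<le> b * b" using b by (intro mult_left_mono) auto
        also have "\<dots> = b\<^sup>2" by (simp add: power2_eq_square)
        finally have "2 * D * exp (- b\<^sup>2) \<le> b\<^sup>2 * exp (- b\<^sup>2)" by (rule mult_right_mono) simp
        also have "\<dots> \<le> 1" by (rule mult_exp_minus_le_1)
        finally have "q \<le> 1 / 2" by (simp add: q_def)
        have "(\<integral>\<^sup>+u. ennreal (\<pi> n u) * indicator {1..} u \<partial>lborel) \<le>
            (\<integral>\<^sup>+u. ennreal (\<pi> n u) * indicator {s_seq p n..} u \<partial>lborel)"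
          using ids(5)[OF n(1)] by (intro nn_integral_mono) (auto simp: indicator_def)
        also note tail
        also have "ennreal q \<le> ennreal (1 / 2)" by (rule ennreal_leI) fact
        finally have mass: "ennreal (1 / 2) \<le> (\<integral>\<^sup>+u. ennreal (\<pi> n u) * indicator {0..1} u \<partial>lborel)"
          by (rule mass_ge_half[OF \<pi>[OF n(1)]])
        have eq: "(b_seq p n)\<^sup>2 * q = D * s_seq p n"
          using ids(3)[OF n(1)] by (simp add: q_def b_def mult_ac)
        show ?case
          using mass tail_of_CB[OF \<pi>[OF n(1)] ids(1)[OF n(1)] ids(4)[OF n(1)] tail, unfolded eq] by (rule conjI)
      qed
    qed (auto simp: D_def)
  qed
qed

text \<open>At most \<open>n\<close> coordinates with risk \<open>O(s_seq p n)\<close> each, and \<open>n * s_seq p n = p n * ln (n / p n)\<close>.\<close>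

lemma noise_risk_eventually:
  fixes p :: "nat \<Rightarrow> real" and \<pi> :: "nat \<Rightarrow> real \<Rightarrow> real"
  assumes p_ball: "\<forall>n\<ge>1. 0 < p n \<and> p n < real n"
    and p_small: "p \<in> o(\<lambda>n. real n)"
    and dens: "\<forall>n\<ge>1. mixing_density (\<pi> n)"
    and conds: "(cond_C2 \<pi> \<and> cond_C3 p \<pi>) \<or> cond_CA p \<pi> \<or> cond_CB p \<pi>"
  obtains A where "0 \<le> A"
    "\<forall>\<^sub>F n in sequentially. \<forall>\<theta>0. (\<Sum>i\<in>{i \<in> {1..n}. \<theta>0 i = 0}.
      \<integral>\<^sup>+y. coord_risk (\<pi> n) (\<theta>0 i) y \<partial>normal_law (\<theta>0 i) 1) \<le> ennreal (A * (p n * ln (n / p n)))"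
proof -
  note p_range = p_ball[rule_format] and \<pi> = dens[rule_format]
  obtain c C where c: "0 < c" and C: "0 \<le> C" and
    ev: "\<forall>\<^sub>F n in sequentially. ennreal c \<le> (\<integral>\<^sup>+u. ennreal (\<pi> n u) * indicator {0..1} u \<partial>lborel) \<and>
      (\<integral>\<^sup>+u. ennreal (min u (b_seq p n ^ 3 / sqrt u) * \<pi> n u) * indicator {s_seq p n..} u \<partial>lborel)
        \<le> ennreal (C * s_seq p n)"
    by (rule mixing_tail_eventually[OF assms])
  define A where "A = 14 + 12 * C / c"
  have A: "0 \<le> A" using c C by (simp add: A_def)
  show thesis
  proof (rule that[OF A])
    show "\<forall>\<^sub>F n in sequentially. \<forall>\<theta>0. (\<Sum>i\<in>{i \<in> {1..n}. \<theta>0 i = 0}.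
      \<integral>\<^sup>+y. coord_risk (\<pi> n) (\<theta>0 i) y \<partial>normal_law (\<theta>0 i) 1) \<le> ennreal (A * (p n * ln (n / p n)))"
      using ev eventually_ge_at_top[of 1] eventually_b_seq_ge[OF p_ball p_small, of 1]
    proof eventually_elim
      case n: (elim n)
      have ids: "s_seq p n = (b_seq p n)\<^sup>2 * exp (- (b_seq p n)\<^sup>2)" "0 < s_seq p n"
        using sequence_identities[of p n] p_range[of n] n by simp_all
      show ?case
      proof
        fix \<theta>0 :: "nat \<Rightarrow> real"
        have "(\<Sum>i\<in>{i \<in> {1..n}. \<theta>0 i = 0}. \<integral>\<^sup>+y. coord_risk (\<pi> n) (\<theta>0 i) y \<partial>normal_law (\<theta>0 i) 1) \<le>
            (\<Sum>i\<in>{i \<in> {1..n}. \<theta>0 i = 0}. ennreal (A * s_seq p n))"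
          using n noise_risk_le[OF \<pi> _ c C ids(1)] by (intro sum_mono) (auto simp: A_def)
        also have "\<dots> \<le> (\<Sum>i\<in>{1..n}. ennreal (A * s_seq p n))"
          by (intro sum_mono2) auto
        also have "\<dots> = ennreal (real n * (A * s_seq p n))"
          using A ids(2) by (simp add: ennreal_of_nat_eq_real_of_nat ennreal_mult''[symmetric])
        also have "real n * (A * s_seq p n) = A * (p n * ln (n / p n))"
          using n by (simp add: s_seq_def)
        finally show "(\<Sum>i\<in>{i \<in> {1..n}. \<theta>0 i = 0}. \<integral>\<^sup>+y. coord_risk (\<pi> n) (\<theta>0 i) y \<partial>normal_law (\<theta>0 i) 1)
          \<le> ennreal (A * (p n * ln (n / p n)))" .
      qed
    qed
  qed
qed

text \<open>At most \<open>p n\<close> coordinates with risk \<open>O(ln (n / p n))\<close> each.\<close>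

lemma signal_risk_eventually:
  fixes p :: "nat \<Rightarrow> real" and \<pi> :: "nat \<Rightarrow> real \<Rightarrow> real"
  assumes p_ball: "\<forall>n\<ge>1. 0 < p n \<and> p n < real n"
    and p_small: "p \<in> o(\<lambda>n. real n)"
    and dens: "\<forall>n\<ge>1. mixing_density (\<pi> n)"
    and C1: "cond_C1 p \<pi>"
  obtains A where "0 \<le> A"
    "\<forall>\<^sub>F n in sequentially. \<forall>\<theta>0\<in>sparse n (p n). (\<Sum>i\<in>{i \<in> {1..n}. \<theta>0 i \<noteq> 0}.
      \<integral>\<^sup>+y. coord_risk (\<pi> n) (\<theta>0 i) y \<partial>normal_law (\<theta>0 i) 1) \<le> ennreal (A * (p n * ln (n / p n)))"
proof -
  note p_range = p_ball[rule_format] and \<pi> = dens[rule_format]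
  from C1 obtain C' K b' u1 where C'0: "C' \<ge> 0" and K: "K \<ge> 0" and b': "b' \<ge> 0" and u1: "u1 \<ge> 1"
    and low: "\<forall>n\<ge>1. \<forall>u\<ge>u1. C' * \<pi> n u \<ge> (p n / n) powr K * exp (- b' * u)"
    unfolding cond_C1_def by (elim conjE exE) (rule that)
  note lower = low[rule_format]
  \<comment> \<open>The lower bound at one point excludes \<open>C' = 0\<close>.\<close>
  have C': "0 < C'"
  proof -
    have "0 < (p 1 / real 1) powr K * exp (- b' * u1)" using p_range[of 1] by simp
    also have "\<dots> \<le> C' * \<pi> 1 u1" by (rule lower) auto
    finally show ?thesis using C'0 by (cases "C' = 0") auto
  qed
  define A where "A = 3 + 2 * (u1\<^sup>2 + (2 * (K + 2 * b' + 2))\<^sup>2 + 4 * C')"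
  have A: "0 \<le> A" using C' by (simp add: A_def)
  show thesis
  proof (rule that[OF A])
    show "\<forall>\<^sub>F n in sequentially. \<forall>\<theta>0\<in>sparse n (p n). (\<Sum>i\<in>{i \<in> {1..n}. \<theta>0 i \<noteq> 0}.
      \<integral>\<^sup>+y. coord_risk (\<pi> n) (\<theta>0 i) y \<partial>normal_law (\<theta>0 i) 1) \<le> ennreal (A * (p n * ln (n / p n)))"
      using eventually_ge_at_top[of 1] eventually_b_seq_ge[OF p_ball p_small, of 1]
    proof eventually_elim
      case n: (elim n)
      have ids: "(b_seq p n)\<^sup>2 = ln (n / p n)" "p n / n = exp (- (b_seq p n)\<^sup>2)"
        using sequence_identities[of p n] p_range[of n] n by simp_all
      have low: "exp (- K * (b_seq p n)\<^sup>2) * exp (- b' * u) \<le> C' * \<pi> n u" if "u1 \<le> u" for u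
        using lower[OF n(1) that] unfolding ids(2) by (simp add: powr_def)
      have risk: "(\<integral>\<^sup>+y. coord_risk (\<pi> n) t y \<partial>normal_law t 1) \<le> ennreal (A * (b_seq p n)\<^sup>2)" for t
        unfolding A_def by (rule signal_risk_le[OF \<pi>[OF n(1)] n(2) K b' u1 C' low])
      show ?case
      proof
        fix \<theta>0 assume "\<theta>0 \<in> sparse n (p n)"
        then have card: "real (card {i \<in> {1..n}. \<theta>0 i \<noteq> 0}) \<le> p n" by (simp add: sparse_def)
        have "(\<Sum>i\<in>{i \<in> {1..n}. \<theta>0 i \<noteq> 0}. \<integral>\<^sup>+y. coord_risk (\<pi> n) (\<theta>0 i) y \<partial>normal_law (\<theta>0 i) 1) \<le>
            (\<Sum>i\<in>{i \<in> {1..n}. \<theta>0 i \<noteq> 0}. ennreal (A * (b_seq p n)\<^sup>2))"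
          by (intro sum_mono risk)
        also have "\<dots> = ennreal (real (card {i \<in> {1..n}. \<theta>0 i \<noteq> 0}) * (A * (b_seq p n)\<^sup>2))"
          using A by (simp add: ennreal_of_nat_eq_real_of_nat ennreal_mult)
        also have "\<dots> \<le> ennreal (p n * (A * (b_seq p n)\<^sup>2))"
          using A by (intro ennreal_leI mult_right_mono card) auto
        finally show "(\<Sum>i\<in>{i \<in> {1..n}. \<theta>0 i \<noteq> 0}. \<integral>\<^sup>+y. coord_risk (\<pi> n) (\<theta>0 i) y \<partial>normal_law (\<theta>0 i) 1)
          \<le> ennreal (A * (p n * ln (n / p n)))"
          unfolding ids(1) by (simp add: mult_ac)
      qed
    qed
  qed
qed

theorem theorem2p1:
  fixes p M :: "nat \<Rightarrow> real" and \<pi> :: "nat \<Rightarrow> real \<Rightarrow> real"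
  assumes p_range: "\<And>n. n \<ge> 1 \<Longrightarrow> 0 < p n \<and> p n < real n"
    and p_small: "p \<in> o(\<lambda>n. real n)"
    and density: "\<And>n. n \<ge> 1 \<Longrightarrow> mixing_density (\<pi> n)"
    and M_pos: "\<And>n. n \<ge> 1 \<Longrightarrow> M n > 0"
    and M_top: "filterlim M at_top sequentially"
  shows
    "(cond_C1 p \<pi> \<longrightarrow>
        (\<lambda>n. sup_exp n (p n) (\<lambda>\<theta>0 x. emeasure (posterior n (\<pi> n) x)
           {\<theta> \<in> space (Rn n). (\<Sum>i | i \<in> {1..n} \<and> \<theta>0 i \<noteq> 0. (\<theta> i - \<theta>0 i)\<^sup>2) > M n * p n * ln (n / p n)}))
          \<longlonglongrightarrow> 0 \<and>
        (\<exists>C0. \<forall>\<^sub>F n in sequentially.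
           sup_exp n (p n) (\<lambda>\<theta>0 x. ennreal
             (\<Sum>i | i \<in> {1..n} \<and> \<theta>0 i \<noteq> 0. (post_mean n (\<pi> n) x i - \<theta>0 i)\<^sup>2))
           \<le> ennreal (C0 * (p n * ln (n / p n))))) \<and>
     ((cond_C2 \<pi> \<and> cond_C3 p \<pi>) \<or> cond_CA p \<pi> \<or> cond_CB p \<pi> \<longrightarrow>
        (\<lambda>n. sup_exp n (p n) (\<lambda>\<theta>0 x. emeasure (posterior n (\<pi> n) x)
           {\<theta> \<in> space (Rn n). (\<Sum>i | i \<in> {1..n} \<and> \<theta>0 i = 0. (\<theta> i)\<^sup>2) > M n * p n * ln (n / p n)}))
          \<longlonglongrightarrow> 0 \<and>
        (\<exists>C0. \<forall>\<^sub>F n in sequentially.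
           sup_exp n (p n) (\<lambda>\<theta>0 x. ennreal
             (\<Sum>i | i \<in> {1..n} \<and> \<theta>0 i = 0. (post_mean n (\<pi> n) x i)\<^sup>2))
           \<le> ennreal (C0 * (p n * ln (n / p n))))) \<and>
     ((cond_C1 p \<pi> \<and> cond_C2 \<pi> \<and> cond_C3 p \<pi>) \<or> (cond_C1 p \<pi> \<and> cond_CA p \<pi>) \<or>
      (cond_C1 p \<pi> \<and> cond_CB p \<pi>) \<longrightarrow>
        (\<lambda>n. sup_exp n (p n) (\<lambda>\<theta>0 x. emeasure (posterior n (\<pi> n) x)
           {\<theta> \<in> space (Rn n). (L2_set (\<lambda>i. \<theta> i - \<theta>0 i) {1..n})\<^sup>2 > M n * p n * ln (n / p n)}))
          \<longlonglongrightarrow> 0 \<and>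
        (\<exists>C0. \<forall>\<^sub>F n in sequentially.
           sup_exp n (p n) (\<lambda>\<theta>0 x. ennreal
             ((L2_set (\<lambda>i. post_mean n (\<pi> n) x i - \<theta>0 i) {1..n})\<^sup>2))
           \<le> ennreal (C0 * (p n * ln (n / p n)))))"
proof -
  have p_ball: "\<forall>n\<ge>1. 0 < p n \<and> p n < real n" and dens: "\<forall>n\<ge>1. mixing_density (\<pi> n)"
    using p_range density by blast+
  define r where "r n = p n * ln (n / p n)" for n :: nat
  have r: "\<forall>\<^sub>F n in sequentially. 0 < r n"
    using eventually_ge_at_top[of 1]
  proof eventually_elim
    case (elim n)
    then show ?case
      using sequence_identities(1,2)[of p n] p_range[of n] by (simp add: r_def flip: sequence_identities(2))
  qed
  have rM: "M n * p n * ln (n / p n) = M n * r n" for n by (simp add: r_def)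
  show ?thesis
    unfolding rM r_def[symmetric]
  proof (intro conjI impI)
    assume C1: "cond_C1 p \<pi>"
    obtain A where A: "0 \<le> A" and risk: "\<forall>\<^sub>F n in sequentially. \<forall>\<theta>0\<in>sparse n (p n).
        (\<Sum>i\<in>{i \<in> {1..n}. \<theta>0 i \<noteq> 0}. \<integral>\<^sup>+y. coord_risk (\<pi> n) (\<theta>0 i) y \<partial>normal_law (\<theta>0 i) 1) \<le> ennreal (A * r n)"
      unfolding r_def by (rule signal_risk_eventually[OF p_ball p_small dens C1])
    note concl = contraction_of_coord_risk[where p = p and S = "\<lambda>n \<theta>0. {i \<in> {1..n}. \<theta>0 i \<noteq> 0}",
      OF dens M_top _ A r risk]
    show "(\<lambda>n. sup_exp n (p n) (\<lambda>\<theta>0 x. emeasure (posterior n (\<pi> n) x)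
        {\<theta> \<in> space (Rn n). (\<Sum>i | i \<in> {1..n} \<and> \<theta>0 i \<noteq> 0. (\<theta> i - \<theta>0 i)\<^sup>2) > M n * r n})) \<longlonglongrightarrow> 0"
      by (rule concl(1)) auto
    show "\<exists>C0. \<forall>\<^sub>F n in sequentially. sup_exp n (p n) (\<lambda>\<theta>0 x. ennreal
        (\<Sum>i | i \<in> {1..n} \<and> \<theta>0 i \<noteq> 0. (post_mean n (\<pi> n) x i - \<theta>0 i)\<^sup>2)) \<le> ennreal (C0 * r n)"
      by (rule exI, rule concl(2)) auto
  next
    assume conds: "(cond_C2 \<pi> \<and> cond_C3 p \<pi>) \<or> cond_CA p \<pi> \<or> cond_CB p \<pi>"
    obtain A where A: "0 \<le> A" and all: "\<forall>\<^sub>F n in sequentially. \<forall>\<theta>0.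
        (\<Sum>i\<in>{i \<in> {1..n}. \<theta>0 i = 0}. \<integral>\<^sup>+y. coord_risk (\<pi> n) (\<theta>0 i) y \<partial>normal_law (\<theta>0 i) 1) \<le> ennreal (A * r n)"
      unfolding r_def by (rule noise_risk_eventually[OF p_ball p_small dens conds])
    have risk: "\<forall>\<^sub>F n in sequentially. \<forall>\<theta>0\<in>sparse n (p n).
        (\<Sum>i\<in>{i \<in> {1..n}. \<theta>0 i = 0}. \<integral>\<^sup>+y. coord_risk (\<pi> n) (\<theta>0 i) y \<partial>normal_law (\<theta>0 i) 1) \<le> ennreal (A * r n)"
      using all by eventually_elim simp
    have "{i \<in> {1..n}. \<theta>0 i = 0} \<subseteq> {1..n}" for n :: nat and \<theta>0 :: "nat \<Rightarrow> real" by auto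
    note concl = contraction_of_coord_risk[where p = p and S = "\<lambda>n \<theta>0. {i \<in> {1..n}. \<theta>0 i = 0}",
      OF dens M_top this A r risk]
    have centre: "(\<Sum>i | i \<in> {1..n} \<and> \<theta>0 i = 0. (f i - \<theta>0 i)\<^sup>2) = (\<Sum>i | i \<in> {1..n} \<and> \<theta>0 i = 0. (f i)\<^sup>2)"
      for n :: nat and \<theta>0 f :: "nat \<Rightarrow> real"
      by (intro sum.cong) auto
    show "(\<lambda>n. sup_exp n (p n) (\<lambda>\<theta>0 x. emeasure (posterior n (\<pi> n) x)
        {\<theta> \<in> space (Rn n). (\<Sum>i | i \<in> {1..n} \<and> \<theta>0 i = 0. (\<theta> i)\<^sup>2) > M n * r n})) \<longlonglongrightarrow> 0"
      using concl(1) unfolding centre .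
    show "\<exists>C0. \<forall>\<^sub>F n in sequentially. sup_exp n (p n) (\<lambda>\<theta>0 x. ennreal
        (\<Sum>i | i \<in> {1..n} \<and> \<theta>0 i = 0. (post_mean n (\<pi> n) x i)\<^sup>2)) \<le> ennreal (C0 * r n)"
      using concl(2) unfolding centre by (rule exI)
  next
    assume "(cond_C1 p \<pi> \<and> cond_C2 \<pi> \<and> cond_C3 p \<pi>) \<or> (cond_C1 p \<pi> \<and> cond_CA p \<pi>) \<or>
      (cond_C1 p \<pi> \<and> cond_CB p \<pi>)"
    then have C1: "cond_C1 p \<pi>" and conds: "(cond_C2 \<pi> \<and> cond_C3 p \<pi>) \<or> cond_CA p \<pi> \<or> cond_CB p \<pi>"
      by auto
    obtain A1 where A1: "0 \<le> A1" and risk1: "\<forall>\<^sub>F n in sequentially. \<forall>\<theta>0\<in>sparse n (p n).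
        (\<Sum>i\<in>{i \<in> {1..n}. \<theta>0 i \<noteq> 0}. \<integral>\<^sup>+y. coord_risk (\<pi> n) (\<theta>0 i) y \<partial>normal_law (\<theta>0 i) 1) \<le> ennreal (A1 * r n)"
      unfolding r_def by (rule signal_risk_eventually[OF p_ball p_small dens C1])
    obtain A2 where A2: "0 \<le> A2" and risk2: "\<forall>\<^sub>F n in sequentially. \<forall>\<theta>0.
        (\<Sum>i\<in>{i \<in> {1..n}. \<theta>0 i = 0}. \<integral>\<^sup>+y. coord_risk (\<pi> n) (\<theta>0 i) y \<partial>normal_law (\<theta>0 i) 1) \<le> ennreal (A2 * r n)"
      unfolding r_def by (rule noise_risk_eventually[OF p_ball p_small dens conds])
    have A: "0 \<le> A1 + A2" using A1 A2 by simp
    from risk1 risk2 r have risk: "\<forall>\<^sub>F n in sequentially. \<forall>\<theta>0\<in>sparse n (p n).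
        (\<Sum>i\<in>{1..n}. \<integral>\<^sup>+y. coord_risk (\<pi> n) (\<theta>0 i) y \<partial>normal_law (\<theta>0 i) 1) \<le> ennreal ((A1 + A2) * r n)"
    proof eventually_elim
      case (elim n)
      show ?case
      proof
        fix \<theta>0 assume \<theta>0: "\<theta>0 \<in> sparse n (p n)"
        let ?R = "\<lambda>i. \<integral>\<^sup>+y. coord_risk (\<pi> n) (\<theta>0 i) y \<partial>normal_law (\<theta>0 i) 1"
        have "(\<Sum>i\<in>{1..n}. ?R i) = (\<Sum>i\<in>{i \<in> {1..n}. \<theta>0 i \<noteq> 0} \<union> {i \<in> {1..n}. \<theta>0 i = 0}. ?R i)"
          by (rule sum.cong) auto
        also have "\<dots> = (\<Sum>i\<in>{i \<in> {1..n}. \<theta>0 i \<noteq> 0}. ?R i) + (\<Sum>i\<in>{i \<in> {1..n}. \<theta>0 i = 0}. ?R i)"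
          by (rule sum.union_disjoint) auto
        also have "\<dots> \<le> ennreal (A1 * r n) + ennreal (A2 * r n)"
          using elim(1,2) \<theta>0 by (intro add_mono) auto
        also have "\<dots> = ennreal ((A1 + A2) * r n)"
          using A1 A2 elim(3) by (simp add: distrib_right)
        finally show "(\<Sum>i\<in>{1..n}. ?R i) \<le> ennreal ((A1 + A2) * r n)" .
      qed
    qed
    note concl = contraction_of_coord_risk[where p = p and S = "\<lambda>n \<theta>0. {1..n}",
      OF dens M_top _ A r risk]
    have L2: "(L2_set f I)\<^sup>2 = (\<Sum>i\<in>I. (f i)\<^sup>2)" for f and I :: "nat set"
      by (simp add: L2_set_def sum_nonneg)
    show "(\<lambda>n. sup_exp n (p n) (\<lambda>\<theta>0 x. emeasure (posterior n (\<pi> n) x)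
        {\<theta> \<in> space (Rn n). (L2_set (\<lambda>i. \<theta> i - \<theta>0 i) {1..n})\<^sup>2 > M n * r n})) \<longlonglongrightarrow> 0"
      unfolding L2 by (rule concl(1)) auto
    show "\<exists>C0. \<forall>\<^sub>F n in sequentially. sup_exp n (p n) (\<lambda>\<theta>0 x. ennreal
        ((L2_set (\<lambda>i. post_mean n (\<pi> n) x i - \<theta>0 i) {1..n})\<^sup>2)) \<le> ennreal (C0 * r n)"
      unfolding L2 by (rule exI, rule concl(2)) auto
  qed
qed

end
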